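(* Every finite simple undirected graph $G$ satisfies $$\min\{s^+(G),s^-(G)\}\ge n^0(G)-\iota(G)+\max\{n^+(G),n^-(G)\}.$$
   Context: All graphs are finite, simple, and undirected. For a graph $G$ with $n$ vertices and adjacency matrix $A=A(G)$, let $\lambda_1,\ldots,\lambda_n$ be the (real) eigenvalues of $A$, counted with multiplicity. The positive square energy and the negative square energy of $G$ are $$s^+(G):=\sum_{\lambda_i>0}\lambda_i^2,\qquad s^-(G):=\sum_{\lambda_i<0}\lambda_i^2.$$ $n^+(G)$, $n^0(G)$, and $n^-(G)$ denote, respectively, the numbers of positive, zero, and negative eigenvalues of the adjacency matrix of $G$, counted with multiplicity. $\iota(G)$ denotes the number of isolated vertices (vertices of degree $0$) of $G$. *)

theory Defs
  imports
    "Graph_Theory.Pair_Digraph"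
    "Jordan_Normal_Form.Char_Poly"
begin

text \<open>
  A finite simple undirected graph is a \<^locale>\<open>pair_graph\<close>: a finite vertex set together with a
  symmetric irreflexive edge relation, so that the edge \<open>uv\<close> is present as both arcs \<open>(u, v)\<close>
  and \<open>(v, u)\<close>. The vertex set may be empty.

  Matrices are indexed by \<open>{0..<n}\<close>, so the adjacency matrix is taken with respect to an enumeration
  \<open>vs\<close> of the vertices; changing the enumeration conjugates it by a permutation matrix.
\<close>

definition vertex_enumeration :: "'a pair_pre_digraph \<Rightarrow> 'a list \<Rightarrow> bool" where
  "vertex_enumeration G vs \<longleftrightarrow> distinct vs \<and> set vs = pverts G"

definition adjacency_matrix :: "'a pair_pre_digraph \<Rightarrow> 'a list \<Rightarrow> real mat" where
  "adjacency_matrix G vs =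
     mat (length vs) (length vs) (\<lambda>(i, j). if (vs ! i, vs ! j) \<in> parcs G then 1 else 0)"

text \<open>
  The eigenvalues with multiplicity, as the multiset of real roots of the characteristic polynomial.
  For the symmetric matrices considered here, all the complex roots are real, so none is lost.
\<close>

definition eigenvalue_mset :: "real mat \<Rightarrow> real multiset" where
  "eigenvalue_mset A = proots (char_poly A)"

definition pos_square_energy :: "real mat \<Rightarrow> real" where
  "pos_square_energy A = (\<Sum>x\<in>#filter_mset (\<lambda>x. x > 0) (eigenvalue_mset A). x\<^sup>2)"

definition neg_square_energy :: "real mat \<Rightarrow> real" where
  "neg_square_energy A = (\<Sum>x\<in>#filter_mset (\<lambda>x. x < 0) (eigenvalue_mset A). x\<^sup>2)"

definition pos_inertia :: "real mat \<Rightarrow> nat" where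
  "pos_inertia A = size (filter_mset (\<lambda>x. x > 0) (eigenvalue_mset A))"

definition zero_inertia :: "real mat \<Rightarrow> nat" where
  "zero_inertia A = size (filter_mset (\<lambda>x. x = 0) (eigenvalue_mset A))"

definition neg_inertia :: "real mat \<Rightarrow> nat" where
  "neg_inertia A = size (filter_mset (\<lambda>x. x < 0) (eigenvalue_mset A))"

text \<open>In a symmetric digraph, the out-degree of \<open>v\<close> is the number of neighbours of \<open>v\<close>.\<close>

definition isolated_count :: "'a pair_pre_digraph \<Rightarrow> nat" where
  "isolated_count G = card {v \<in> pverts G. out_degree (with_proj G) v = 0}"

end

theory Submission
  imports Defs
    "HOL-Analysis.L2_Norm"
    "Jordan_Normal_Form.Schur_Decomposition"
    "Jordan_Normal_Form.Spectral_Radius"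
begin

text \<open>
Let \<open>A = B - C\<close> be the decomposition of the adjacency matrix into its positive part \<open>B\<close> and its
negative part \<open>C\<close>, two positive semidefinite matrices with \<open>B C = 0\<close>. The positive and negative
square energies are the squared Frobenius norms of \<open>B\<close> and \<open>C\<close>. If \<open>m\<close> is the number of
non-isolated vertices, the claim says that each of these two norms is at least \<open>m - n\<^sup>+\<close> and at
least \<open>m - n\<^sup>-\<close>. The two energies need different arguments.

The bound for the negative energy is a sum of inequalities at the single vertices. Let \<open>\<beta> i\<close> and
\<open>\<gamma> i\<close> be the squared norms of the rows \<open>i\<close> of \<open>B\<close> and \<open>C\<close>. From \<open>A B = B B\<close> and \<open>A C = - C C\<close>,
\<open>\<beta> i\<close> is the sum of \<open>B i l\<close> and \<open>\<gamma> i\<close> is the sum of \<open>1 - B i l\<close>, both over the neighbours \<open>l\<close> of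
\<open>i\<close>; this is where it matters that the entries of \<open>A\<close> are 0 and 1. Call \<open>(B l i)\<^sup>2 / \<beta> l\<close> the share
of \<open>i\<close> in row \<open>l\<close>. The shares in one row add up to 1. The core of the proof is that \<open>\<gamma> i\<close> dominates
the sum of the shares of \<open>i\<close> in the rows of its neighbours, with some room to spare
(\<open>vertex_bound_\<beta>\<close>, \<open>vertex_bound_\<gamma>\<close>). Summed over all \<open>i\<close>, the shares give 1 for every row, except
for the diagonal and for the non-neighbours. The room to spare pays for the non-neighbours, and what
is lost on the diagonal is the sum of \<open>(B i i)\<^sup>2 / \<beta> i\<close> or, in the second version, of
\<open>(B i i)\<^sup>2 / \<gamma> i\<close>. By the Cauchy--Schwarz inequality these sums are at most the ranks of \<open>B\<close> and of
\<open>C\<close>, which are \<open>n\<^sup>+\<close> and \<open>n\<^sup>-\<close>.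

The inequality at a vertex has two sources. By the Schur product theorem the entrywise square of
\<open>B\<close> is positive semidefinite, and its row sums are the \<open>\<beta> l\<close>; this prevents the shares of \<open>i\<close> in the
rows of its neighbours from being all large (\<open>deficit_ge_\<beta>\<close>). Since \<open>C\<close> is positive semidefinite as
well and lies entrywise below \<open>B\<close>, the average share is at most one half (\<open>deficit_ge_half_degree\<close>).
Vertices of degree 1 are treated directly.

For the positive energy, non-negative test vectors are enough. A vertex with an inclusion-minimal
neighbourhood \<open>N\<close> and the set \<open>T\<close> of all vertices with neighbourhood \<open>N\<close> span a complete bipartite
subgraph, and the block of \<open>B\<close> on \<open>T \<union> N\<close> has squared norm at least \<open>|T| |N| \<ge> |T| + |N| - 1\<close>.
Removing \<open>T \<union> N\<close> leaves no new isolated vertex, so the non-isolated vertices split into \<open>k\<close> such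
blocks and the energy is at least \<open>m - k\<close>. One vertex from each \<open>T\<close> gives a set of \<open>k\<close> independent
vertices on whose span \<open>A\<close> is injective while its quadratic form vanishes. Such a space meets the
kernels of \<open>B\<close> and \<open>C\<close> only in 0, hence \<open>k \<le> n\<^sup>+\<close> and \<open>k \<le> n\<^sup>-\<close> (\<open>isotropic_card_le_inertia\<close>).
\<close>

section \<open>Elementary inequalities and linear systems\<close>

lemma Cauchy_Schwarz_sum:
  fixes a b :: "'k \<Rightarrow> real"
  shows "(\<Sum>k\<in>K. a k * b k)\<^sup>2 \<le> (\<Sum>k\<in>K. (a k)\<^sup>2) * (\<Sum>k\<in>K. (b k)\<^sup>2)"
proof -
  have "\<bar>\<Sum>k\<in>K. a k * b k\<bar> \<le> L2_set a K * L2_set b K"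
    using order_trans[OF sum_abs L2_set_mult_ineq[of a b K, folded abs_mult]] .
  then have "(\<Sum>k\<in>K. a k * b k)\<^sup>2 \<le> (L2_set a K * L2_set b K)\<^sup>2"
    by (rule abs_le_square_iff[THEN iffD1, OF order_trans[OF _ abs_ge_self]])
  then show ?thesis
    by (simp add: L2_set_def power_mult_distrib sum_nonneg)
qed

text \<open>
The Cauchy--Schwarz inequality for pairs. It is stated without square roots because its
applications bound only \<open>u\<^sup>2\<close> and \<open>v\<^sup>2\<close>.
\<close>
lemma square_sum_le_product:
  fixes a b c d u v :: real
  assumes "0 \<le> a" "0 \<le> b" "0 \<le> c" "0 \<le> d" and u: "u\<^sup>2 \<le> a * c" and v: "v\<^sup>2 \<le> b * d"
  shows "(u + v)\<^sup>2 \<le> (a + b) * (c + d)"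
proof -
  have "(2 * (u * v))\<^sup>2 = 4 * (u\<^sup>2 * v\<^sup>2)" by (simp add: power_mult_distrib)
  also have "\<dots> \<le> 4 * ((a * c) * (b * d))"
    using assms by (intro mult_left_mono mult_mono) auto
  also have "\<dots> \<le> (a * d + b * c)\<^sup>2"
    using sum_squares_bound[of "a * d" "b * c"] by (simp add: power2_eq_square algebra_simps)
  finally have "2 * (u * v) \<le> a * d + b * c"
    by (rule power2_le_imp_le) (use assms in auto)
  with u v show ?thesis by (simp add: power2_eq_square algebra_simps)
qed

text \<open>
Gaussian elimination: an equation with a non-zero coefficient at the unknown \<open>v\<close> is used to
eliminate \<open>v\<close> from the other equations.
\<close>
lemma homogeneous_system_solution:
  fixes a :: "'l \<Rightarrow> 'u \<Rightarrow> real"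
  assumes "finite L" "finite U" "card L < card U"
  shows "\<exists>c. (\<exists>u\<in>U. c u \<noteq> 0) \<and> (\<forall>k\<in>L. (\<Sum>u\<in>U. c u * a k u) = 0)"
  using assms
proof (induction L arbitrary: U a rule: finite_induct)
  case empty
  then have "U \<noteq> {}" by auto
  then show ?case by (intro exI[of _ "\<lambda>_. 1"]) auto
next
  case (insert l L)
  show ?case
  proof (cases "\<forall>u\<in>U. a l u = 0")
    case True
    from insert have "card L < card U" by simp
    from insert.IH[OF insert.prems(1) this, of a] True show ?thesis by auto
  next
    case False
    then obtain v where v: "v \<in> U" "a l v \<noteq> 0" by auto
    let ?U = "U - {v}"
    define a' where "a' = (\<lambda>k u. a k u - a k v * a l u / a l v)"
    have "card L < card ?U" using insert v by simp
    then obtain c where c: "\<exists>u\<in>?U. c u \<noteq> 0" "\<And>k. k \<in> L \<Longrightarrow> (\<Sum>u\<in>?U. c u * a' k u) = 0"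
      using insert.IH[of ?U a'] insert.prems(1) by auto
    define s where "s = (\<Sum>u\<in>?U. c u * a l u)"
    define c' where "c' = c(v := - s / a l v)"
    have eq: "(\<Sum>u\<in>U. c' u * a k u) = - s / a l v * a k v + (\<Sum>u\<in>?U. c u * a k u)" for k
    proof -
      have "(\<Sum>u\<in>U. c' u * a k u) = c' v * a k v + (\<Sum>u\<in>?U. c' u * a k u)"
        by (rule sum.remove) (use insert.prems v in auto)
      also have "(\<Sum>u\<in>?U. c' u * a k u) = (\<Sum>u\<in>?U. c u * a k u)"
        by (intro sum.cong refl) (simp add: c'_def)
      finally show ?thesis by (simp add: c'_def)
    qed
    have "(\<Sum>u\<in>U. c' u * a k u) = 0" if "k \<in> insert l L" for k
    proof (cases "k = l")
      case True
      then show ?thesis unfolding eq using v by (simp add: s_def)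
    next
      case False
      have "(\<Sum>u\<in>?U. c u * a' k u) = (\<Sum>u\<in>?U. c u * a k u) - s * a k v / a l v"
        unfolding s_def a'_def right_diff_distrib sum_subtractf sum_distrib_right sum_divide_distrib
        by (simp add: algebra_simps)
      then show ?thesis unfolding eq using c(2) that False by simp
    qed
    moreover have "\<exists>u\<in>U. c' u \<noteq> 0" using c(1) by (auto simp: c'_def)
    ultimately show ?thesis by blast
  qed
qed

section \<open>The spectral theorem for real symmetric matrices\<close>

text \<open>
A complex eigenvalue \<open>z\<close> exists by algebraic closedness. For an eigenvector \<open>v\<close>, both \<open>v\<^sup>* v\<close> and
\<open>v\<^sup>* A v = z v\<^sup>* v\<close> are real by symmetry, so \<open>z\<close> is a real root of the characteristic polynomial.
\<close>
lemma symmetric_real_mat_eigenvalue: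
  fixes A :: "real mat"
  assumes A: "A \<in> carrier_mat n n" and n: "0 < n" and sym: "A\<^sup>T = A"
  shows "\<exists>e. eigenvalue A e"
proof -
  let ?A = "map_mat complex_of_real A"
  have A': "?A \<in> carrier_mat n n" using A by simp
  have A_sym: "A $$ (i, j) = A $$ (j, i)" if "i < n" "j < n" for i j
    using that A arg_cong[OF sym, of "\<lambda>M. M $$ (i, j)"] by simp
  obtain z where "eigenvalue ?A z"
    using spectrum_non_empty[OF A' n] by (auto simp: spectrum_def)
  then obtain v where v: "v \<in> carrier_vec n" "v \<noteq> 0\<^sub>v n" "?A *\<^sub>v v = z \<cdot>\<^sub>v v"
    using A by (auto simp: eigenvalue_def eigenvector_def)
  have row: "z * v $ i = (\<Sum>j<n. complex_of_real (A $$ (i, j)) * v $ j)" if i: "i < n" for i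
  proof -
    have "z * v $ i = (?A *\<^sub>v v) $ i" using v i by simp
    also have "\<dots> = (\<Sum>j<n. complex_of_real (A $$ (i, j)) * v $ j)"
      using i v(1) A by (simp add: scalar_prod_def lessThan_atLeast0)
    finally show ?thesis .
  qed
  define N where "N = (\<Sum>i<n. v $ i * cnj (v $ i))"
  define Q where "Q = (\<Sum>i<n. \<Sum>j<n. complex_of_real (A $$ (i, j)) * v $ j * cnj (v $ i))"
  have "z * N = Q"
    unfolding N_def Q_def sum_distrib_left
    by (intro sum.cong refl) (simp add: row[symmetric] sum_distrib_right[symmetric] mult.assoc[symmetric])
  have "cnj Q = (\<Sum>i<n. \<Sum>j<n. complex_of_real (A $$ (i, j)) * cnj (v $ j) * v $ i)"
    by (simp add: Q_def)
  also have "\<dots> = (\<Sum>j<n. \<Sum>i<n. complex_of_real (A $$ (i, j)) * cnj (v $ j) * v $ i)"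
    by (rule sum.swap)
  also have "\<dots> = Q"
    unfolding Q_def by (intro sum.cong refl) (simp add: A_sym ac_simps)
  finally have "cnj Q = Q" .
  have N: "N = complex_of_real (\<Sum>i<n. (cmod (v $ i))\<^sup>2)"
    unfolding N_def of_real_sum by (intro sum.cong refl complex_norm_square[symmetric])
  obtain i where i: "i < n" "v $ i \<noteq> 0"
    using v(1,2) by (metis carrier_vecD eq_vecI index_zero_vec(1) index_zero_vec(2))
  have "(\<Sum>i<n. (cmod (v $ i))\<^sup>2) \<noteq> 0"
    using i by (subst sum_nonneg_eq_0_iff) auto
  then have N0: "N \<noteq> 0" unfolding N by (simp only: of_real_eq_0_iff not_False_eq_True)
  have "cnj z * N = z * N"
    using \<open>z * N = Q\<close> \<open>cnj Q = Q\<close> N by (metis complex_cnj_complex_of_real complex_cnj_mult)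
  with N0 have "cnj z = z" by simp
  then obtain e where e: "z = complex_of_real e"
    by (metis Reals_cases Reals_cnj_iff)
  have "poly (char_poly ?A) z = 0"
    using \<open>eigenvalue ?A z\<close> eigenvalue_root_char_poly[OF A'] by simp
  then have "poly (char_poly A) e = 0"
    unfolding e of_real_hom.char_poly_hom[OF A] by simp
  then show ?thesis using eigenvalue_root_char_poly[OF A] by auto
qed

text \<open>
Complete \<open>v\<close> to a basis, apply the Gram--Schmidt process, which keeps the first vector, and
normalise.
\<close>
lemma orthogonal_mat_with_first_column:
  fixes v :: "real vec"
  assumes v: "v \<in> carrier_vec n" "v \<noteq> 0\<^sub>v n"
  shows "\<exists>W \<in> carrier_mat n n. \<exists>c. W\<^sup>T * W = 1\<^sub>m n \<and> col W 0 = c \<cdot>\<^sub>v v"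
proof -
  interpret cof_vec_space n "TYPE(real)" .
  define b where "b = basis_completion v"
  define ws where "ws = gram_schmidt n b"
  from basis_completion[OF v, folded b_def]
  have dist_b: "distinct b" and indep: "\<not> lin_dep (set b)" and b: "set b \<subseteq> carrier_vec n"
    and hdb: "hd b = v" and len_b: "length b = n" by auto
  have n: "0 < n" using v by (cases n) auto
  from hdb len_b n obtain vs where bv: "b = v # vs" by (cases b) auto
  from gram_schmidt_result[OF b dist_b indep refl, folded ws_def]
  have ws: "set ws \<subseteq> carrier_vec n" "corthogonal ws" "length ws = n" by (auto simp: len_b)
  from gram_schmidt_hd[OF v(1), of vs, folded bv] have hdws: "hd ws = v" unfolding ws_def .
  have cconj: "conjugate w = w" for w :: "real vec" by (rule eq_vecI) auto
  have orth: "(ws ! i \<bullet> ws ! j = 0) = (i \<noteq> j)" if "i < n" "j < n" for i j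
    using corthogonalD[OF ws(2), of i j] that ws(3) by (simp add: cconj)
  have wc: "ws ! i \<in> carrier_vec n" if "i < n" for i using ws that by auto
  have pos: "0 < ws ! i \<bullet> ws ! i" if "i < n" for i
  proof -
    have "0 \<le> ws ! i \<bullet> ws ! i" by (simp add: scalar_prod_def sum_nonneg)
    with orth[OF that that] show ?thesis by simp
  qed
  define c where "c = (\<lambda>i. 1 / sqrt (ws ! i \<bullet> ws ! i))"
  define W where "W = mat_of_cols n (map (\<lambda>i. c i \<cdot>\<^sub>v ws ! i) [0..<n])"
  have W: "W \<in> carrier_mat n n" by (simp add: W_def mat_of_cols_def)
  have col: "col W i = c i \<cdot>\<^sub>v ws ! i" if "i < n" for i
    using that wc[OF that] by (simp add: W_def)
  have "W\<^sup>T * W = 1\<^sub>m n"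
  proof (rule eq_matI)
    fix i j assume ij: "i < dim_row (1\<^sub>m n :: real mat)" "j < dim_col (1\<^sub>m n :: real mat)"
    then have "(W\<^sup>T * W) $$ (i, j) = c i * c j * (ws ! i \<bullet> ws ! j)"
      using W wc[of i] wc[of j] by (simp add: col)
    also have "\<dots> = (1\<^sub>m n :: real mat) $$ (i, j)"
    proof (cases "i = j")
      case True
      then show ?thesis using pos[of i] ij by (simp add: c_def)
    next
      case False
      then show ?thesis using orth[of i j] ij by simp
    qed
    finally show "(W\<^sup>T * W) $$ (i, j) = (1\<^sub>m n :: real mat) $$ (i, j)" .
  qed (use W in auto)
  moreover have "col W 0 = c 0 \<cdot>\<^sub>v v"
    using col[OF n] hdws ws(3) n by (cases ws) auto
  ultimately show ?thesis using W by blast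
qed

text \<open>
Conjugating by an orthogonal matrix whose first column is an eigenvector gives a matrix that is
still symmetric and has first column \<open>(e, 0, \<dots>, 0)\<close>. It is therefore block diagonal, and the
induction hypothesis applies to the remaining block.
\<close>
lemma symmetric_real_mat_diagonalization:
  fixes A :: "real mat"
  assumes "A \<in> carrier_mat n n" and "A\<^sup>T = A"
  shows "\<exists>P \<in> carrier_mat n n. \<exists>D \<in> carrier_mat n n.
    P\<^sup>T * P = 1\<^sub>m n \<and> diagonal_mat D \<and> A = P * D * P\<^sup>T"
  using assms
proof (induction n arbitrary: A)
  case 0
  then have "A = 1\<^sub>m 0 * A * (1\<^sub>m 0)\<^sup>T" by (intro eq_matI) auto
  with 0 show ?case by (intro bexI[of _ "1\<^sub>m 0"] bexI[of _ A]) (auto simp: diagonal_mat_def)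
next
  case (Suc n)
  note A = Suc.prems(1) and sym = Suc.prems(2)
  obtain e where "eigenvalue A e" using symmetric_real_mat_eigenvalue[OF A _ sym] by auto
  then obtain v where v: "v \<in> carrier_vec (Suc n)" "v \<noteq> 0\<^sub>v (Suc n)" "A *\<^sub>v v = e \<cdot>\<^sub>v v"
    using A by (auto simp: eigenvalue_def eigenvector_def)
  obtain W c where W: "W \<in> carrier_mat (Suc n) (Suc n)" and WW: "W\<^sup>T * W = 1\<^sub>m (Suc n)"
    and W0: "col W 0 = c \<cdot>\<^sub>v v"
    using orthogonal_mat_with_first_column[OF v(1,2)] by blast
  have WT: "W\<^sup>T \<in> carrier_mat (Suc n) (Suc n)" using W by simp
  have WW': "W * W\<^sup>T = 1\<^sub>m (Suc n)" by (rule mat_mult_left_right_inverse[OF WT W WW])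
  define M where "M = W\<^sup>T * (A * W)"
  have M: "M \<in> carrier_mat (Suc n) (Suc n)" using W A by (simp add: M_def)
  have Msym: "M\<^sup>T = M"
  proof -
    have "M\<^sup>T = (A * W)\<^sup>T * W"
      unfolding M_def using W A WT by (subst transpose_mult[OF WT]) auto
    also have "\<dots> = W\<^sup>T * A * W" using transpose_mult[OF A W] sym by simp
    also have "\<dots> = M" unfolding M_def by (rule assoc_mult_mat[OF WT A W])
    finally show ?thesis .
  qed
  have AM: "A = W * M * W\<^sup>T"
  proof -
    have "W * M = (W * W\<^sup>T) * (A * W)"
      unfolding M_def by (rule assoc_mult_mat[symmetric, OF W WT]) (use A W in auto)
    then have "W * M = A * W" using WW' A W by simp
    then have "W * M * W\<^sup>T = A * (W * W\<^sup>T)" using assoc_mult_mat[OF A W WT] by simp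
    then show ?thesis using WW' A by simp
  qed
  have AW0: "A *\<^sub>v col W 0 = e \<cdot>\<^sub>v col W 0"
    unfolding W0 using mult_mat_vec[OF A v(1), of c] v(1,3)
    by (simp add: smult_smult_assoc mult.commute)
  have M0: "M $$ (i, 0) = (if i = 0 then e else 0)" if i: "i < Suc n" for i
  proof -
    have "M $$ (i, 0) = row (W\<^sup>T) i \<bullet> col (A * W) 0"
      unfolding M_def using i W A by simp
    also have "col (A * W) 0 = A *\<^sub>v col W 0" using A W by (intro eq_vecI) auto
    also have "\<dots> = e \<cdot>\<^sub>v col W 0" by (rule AW0)
    also have "row (W\<^sup>T) i \<bullet> (e \<cdot>\<^sub>v col W 0) = e * (W\<^sup>T * W) $$ (i, 0)"
      using i W by simp
    also have "\<dots> = (if i = 0 then e else 0)" unfolding WW using i by simp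
    finally show ?thesis .
  qed
  obtain M1 M2 M3 M4 where split: "split_block M 1 1 = (M1, M2, M3, M4)"
    by (cases "split_block M 1 1") auto
  from split_block[OF split, of n n] M
  have Mc: "M1 \<in> carrier_mat 1 1" "M2 \<in> carrier_mat 1 n" "M3 \<in> carrier_mat n 1" "M4 \<in> carrier_mat n n"
    and Mb: "M = four_block_mat M1 M2 M3 M4" by auto
  have entry: "M $$ (i, j) = M $$ (j, i)" if "i < Suc n" "j < Suc n" for i j
    using that M arg_cong[OF Msym, of "\<lambda>X. X $$ (i, j)"] by simp
  have M3: "M3 = 0\<^sub>m n 1"
  proof (rule eq_matI)
    fix i j assume "i < dim_row (0\<^sub>m n 1 :: real mat)" "j < dim_col (0\<^sub>m n 1 :: real mat)"
    then show "M3 $$ (i, j) = (0\<^sub>m n 1 :: real mat) $$ (i, j)"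
      using M0[of "Suc i"] Mc unfolding Mb by simp
  qed (use Mc in auto)
  have M2: "M2 = 0\<^sub>m 1 n"
  proof (rule eq_matI)
    fix i j assume "i < dim_row (0\<^sub>m 1 n :: real mat)" "j < dim_col (0\<^sub>m 1 n :: real mat)"
    then show "M2 $$ (i, j) = (0\<^sub>m 1 n :: real mat) $$ (i, j)"
      using M0[of "Suc j"] entry[of 0 "Suc j"] Mc unfolding Mb by simp
  qed (use Mc in auto)
  have M4: "M4\<^sup>T = M4"
  proof (rule eq_matI)
    fix i j assume "i < dim_row M4" "j < dim_col M4"
    then show "M4\<^sup>T $$ (i, j) = M4 $$ (i, j)"
      using entry[of "Suc i" "Suc j"] Mc unfolding Mb by simp
  qed (use Mc in auto)
  obtain P D where P: "P \<in> carrier_mat n n" and D: "D \<in> carrier_mat n n"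
    and PP: "P\<^sup>T * P = 1\<^sub>m n" and diag: "diagonal_mat D" and M4_eq: "M4 = P * D * P\<^sup>T"
    using Suc.IH[OF Mc(4) M4] by blast
  define P' where "P' = four_block_mat (1\<^sub>m 1) (0\<^sub>m 1 n) (0\<^sub>m n 1) P"
  define D' where "D' = four_block_mat M1 (0\<^sub>m 1 n) (0\<^sub>m n 1) D"
  have P': "P' \<in> carrier_mat (Suc n) (Suc n)" and D': "D' \<in> carrier_mat (Suc n) (Suc n)"
    using P D Mc by (auto simp: P'_def D'_def)
  have P'T: "P'\<^sup>T = four_block_mat (1\<^sub>m 1) (0\<^sub>m 1 n) (0\<^sub>m n 1) (P\<^sup>T)"
    unfolding P'_def using P by (subst transpose_four_block_mat) auto
  have P'P': "P'\<^sup>T * P' = 1\<^sub>m (Suc n)"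
    unfolding P'T unfolding P'_def using P PP
    by (subst mult_four_block_mat[of _ 1 1 _ n _ n _ _ 1 _ n]) auto
  have M_eq: "P' * D' * P'\<^sup>T = M"
  proof -
    have "P' * D' = four_block_mat M1 (0\<^sub>m 1 n) (0\<^sub>m n 1) (P * D)"
      unfolding P'_def D'_def using P D Mc
      by (subst mult_four_block_mat[of _ 1 1 _ n _ n _ _ 1 _ n]) auto
    then have "P' * D' * P'\<^sup>T = four_block_mat M1 (0\<^sub>m 1 n) (0\<^sub>m n 1) (P * D * P\<^sup>T)"
      unfolding P'T using P D Mc
      by (simp, subst mult_four_block_mat[of _ 1 1 _ n _ n _ _ 1 _ n]) auto
    then show ?thesis unfolding Mb M2 M3 M4_eq .
  qed
  have "A = W * (P' * D' * P'\<^sup>T) * W\<^sup>T" unfolding M_eq by (rule AM)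
  also have "\<dots> = (W * P') * D' * (W * P')\<^sup>T"
    using W P' D' WT by (simp add: transpose_mult[OF W P'] assoc_mult_mat[of _ "Suc n" "Suc n" _ "Suc n" _ "Suc n"])
  finally have A_eq: "A = (W * P') * D' * (W * P')\<^sup>T" .
  have "(W * P')\<^sup>T * (W * P') = P'\<^sup>T * (W\<^sup>T * W) * P'"
    using W P' WT by (simp add: transpose_mult[OF W P'] assoc_mult_mat[of _ "Suc n" "Suc n" _ "Suc n" _ "Suc n"])
  then have orth: "(W * P')\<^sup>T * (W * P') = 1\<^sub>m (Suc n)"
    using WW P'P' P' by simp
  have "diagonal_mat D'"
    using diag D Mc unfolding D'_def diagonal_mat_def by auto
  then show ?case using A_eq orth W P' D' by (intro bexI[of _ "W * P'"] bexI[of _ D']) auto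
qed

section \<open>Functions of the adjacency matrix\<close>

text \<open>
An eigenbasis \<open>\<psi>\<close> of the adjacency matrix, indexed by an arbitrary finite set \<open>K\<close>. The vertices are
an arbitrary set as well, so that the argument runs over sums indexed by vertices and not over
matrices of fixed dimension.
\<close>
locale adjacency_eigenbasis =
  fixes V :: "'v set" and adj :: "'v \<Rightarrow> 'v \<Rightarrow> bool"
    and K :: "'k set" and ev :: "'k \<Rightarrow> real" and \<psi> :: "'k \<Rightarrow> 'v \<Rightarrow> real"
  assumes finite_V: "finite V" and finite_K: "finite K"
    and adj_sym: "x \<in> V \<Longrightarrow> y \<in> V \<Longrightarrow> adj x y \<Longrightarrow> adj y x"
    and adj_irrefl: "x \<in> V \<Longrightarrow> \<not> adj x x"
    and orthonormal: "k \<in> K \<Longrightarrow> l \<in> K \<Longrightarrow> (\<Sum>x\<in>V. \<psi> k x * \<psi> l x) = of_bool (k = l)"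
    and spectral: "x \<in> V \<Longrightarrow> y \<in> V \<Longrightarrow> of_bool (adj x y) = (\<Sum>k\<in>K. ev k * \<psi> k x * \<psi> k y)"
begin

text \<open>
The matrix with eigenvectors \<open>\<psi> k\<close> and eigenvalues \<open>\<mu> k\<close>, that is, the functional calculus of the
adjacency matrix.
\<close>
definition calculus :: "('k \<Rightarrow> real) \<Rightarrow> 'v \<Rightarrow> 'v \<Rightarrow> real" where
  "calculus \<mu> x y = (\<Sum>k\<in>K. \<mu> k * \<psi> k x * \<psi> k y)"

lemma calculus_sym: "calculus \<mu> x y = calculus \<mu> y x"
  by (simp add: calculus_def mult.assoc mult.commute mult.left_commute)

lemma calculus_mult:
  "(\<Sum>y\<in>V. calculus \<mu> x y * calculus \<nu> y z) = calculus (\<lambda>k. \<mu> k * \<nu> k) x z"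
proof -
  have "(\<Sum>y\<in>V. calculus \<mu> x y * calculus \<nu> y z)
      = (\<Sum>y\<in>V. \<Sum>k\<in>K. \<Sum>l\<in>K. \<mu> k * \<psi> k x * \<nu> l * \<psi> l z * (\<psi> k y * \<psi> l y))"
    unfolding calculus_def sum_product by (intro sum.cong refl) (simp add: algebra_simps)
  also have "\<dots> = (\<Sum>k\<in>K. \<Sum>l\<in>K. \<mu> k * \<psi> k x * \<nu> l * \<psi> l z * (\<Sum>y\<in>V. \<psi> k y * \<psi> l y))"
    by (subst sum.swap, rule sum.cong, rule refl, subst sum.swap) (simp add: sum_distrib_left)
  also have "\<dots> = (\<Sum>k\<in>K. \<Sum>l\<in>K. if k = l then \<mu> k * \<psi> k x * \<nu> l * \<psi> l z else 0)"
    by (intro sum.cong refl) (simp add: orthonormal)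
  also have "\<dots> = (\<Sum>k\<in>K. \<mu> k * \<psi> k x * \<nu> k * \<psi> k z)"
    by (simp add: finite_K)
  finally show ?thesis by (simp add: calculus_def algebra_simps)
qed

lemma calculus_trace: "(\<Sum>x\<in>V. calculus \<mu> x x) = (\<Sum>k\<in>K. \<mu> k)"
proof -
  have "(\<Sum>x\<in>V. calculus \<mu> x x) = (\<Sum>k\<in>K. \<mu> k * (\<Sum>x\<in>V. \<psi> k x * \<psi> k x))"
    unfolding calculus_def by (subst sum.swap) (simp add: sum_distrib_left mult.assoc)
  then show ?thesis by (simp add: orthonormal)
qed

lemma calculus_form:
  "(\<Sum>y\<in>W. \<Sum>z\<in>W. v y * v z * calculus \<mu> y z) = (\<Sum>k\<in>K. \<mu> k * (\<Sum>y\<in>W. v y * \<psi> k y)\<^sup>2)"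
proof -
  have "(\<Sum>y\<in>W. \<Sum>z\<in>W. v y * v z * calculus \<mu> y z)
      = (\<Sum>y\<in>W. \<Sum>z\<in>W. \<Sum>k\<in>K. \<mu> k * ((v y * \<psi> k y) * (v z * \<psi> k z)))"
    unfolding calculus_def sum_distrib_left by (simp add: algebra_simps)
  also have "\<dots> = (\<Sum>k\<in>K. \<Sum>y\<in>W. \<Sum>z\<in>W. \<mu> k * ((v y * \<psi> k y) * (v z * \<psi> k z)))"
    by (subst (2) sum.swap, subst sum.swap, rule refl)
  also have "\<dots> = (\<Sum>k\<in>K. \<mu> k * (\<Sum>y\<in>W. v y * \<psi> k y)\<^sup>2)"
    by (intro sum.cong refl) (simp only: power2_eq_square sum_product, simp only: sum_distrib_left)
  finally show ?thesis .
qed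

text \<open>
The Cauchy--Schwarz inequality for the positive semidefinite form \<open>calculus \<mu>\<close>, applied to \<open>v\<close> and
to the unit vector at \<open>x\<close>.
\<close>
lemma calculus_Cauchy_Schwarz:
  assumes "\<And>k. k \<in> K \<Longrightarrow> 0 \<le> \<mu> k"
  shows "(\<Sum>y\<in>W. v y * calculus \<mu> x y)\<^sup>2
    \<le> calculus \<mu> x x * (\<Sum>y\<in>W. \<Sum>z\<in>W. v y * v z * calculus \<mu> y z)"
proof -
  define r where "r = (\<lambda>k. sqrt (\<mu> k))"
  define a where "a = (\<lambda>k. r k * \<psi> k x)"
  define b where "b = (\<lambda>k. r k * (\<Sum>y\<in>W. v y * \<psi> k y))"
  have s: "\<mu> k = r k * r k" if "k \<in> K" for k using assms[OF that] by (simp add: r_def)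
  have "(\<Sum>y\<in>W. v y * calculus \<mu> x y) = (\<Sum>k\<in>K. (\<Sum>y\<in>W. \<mu> k * \<psi> k x * (v y * \<psi> k y)))"
    unfolding calculus_def sum_distrib_left by (subst sum.swap) (simp add: algebra_simps)
  also have "\<dots> = (\<Sum>k\<in>K. a k * b k)"
    unfolding a_def b_def
    by (intro sum.cong refl) (simp add: sum_distrib_left s ac_simps)
  finally have 1: "(\<Sum>y\<in>W. v y * calculus \<mu> x y) = (\<Sum>k\<in>K. a k * b k)" .
  have 2: "calculus \<mu> x x = (\<Sum>k\<in>K. (a k)\<^sup>2)"
    unfolding calculus_def a_def power2_eq_square
    by (intro sum.cong refl) (simp add: s algebra_simps)
  have 3: "(\<Sum>y\<in>W. \<Sum>z\<in>W. v y * v z * calculus \<mu> y z) = (\<Sum>k\<in>K. (b k)\<^sup>2)"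
    unfolding calculus_form b_def power2_eq_square
    by (intro sum.cong refl) (simp add: s ac_simps)
  show ?thesis
    unfolding 1 2 3 by (rule Cauchy_Schwarz_sum)
qed

text \<open>
The same inequality for the entrywise square. By the Schur product theorem that square is positive
semidefinite: a Gram representation of \<open>calculus \<mu>\<close> by vectors indexed by \<open>K\<close> gives one of its
entrywise square by their tensor squares, indexed by \<open>K \<times> K\<close>.
\<close>
lemma calculus_square_Cauchy_Schwarz:
  assumes "\<And>k. k \<in> K \<Longrightarrow> 0 \<le> \<mu> k"
  shows "(\<Sum>y\<in>W. v y * (calculus \<mu> x y)\<^sup>2)\<^sup>2
    \<le> (calculus \<mu> x x)\<^sup>2 * (\<Sum>y\<in>W. \<Sum>z\<in>W. v y * v z * (calculus \<mu> y z)\<^sup>2)"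
proof -
  define \<phi> where "\<phi> = (\<lambda>(k, l) y. \<psi> k y * \<psi> l y)"
  define r where "r = (\<lambda>q. sqrt (\<mu> (fst q) * \<mu> (snd q)))"
  define a where "a = (\<lambda>q. r q * \<phi> q x)"
  define b where "b = (\<lambda>q. r q * (\<Sum>y\<in>W. v y * \<phi> q y))"
  let ?P = "K \<times> K"
  have s: "\<mu> (fst q) * \<mu> (snd q) = r q * r q"
    if "q \<in> ?P" for q using that assms by (auto simp: r_def mem_Times_iff)
  have sq: "(calculus \<mu> y z)\<^sup>2 = (\<Sum>q\<in>?P. \<mu> (fst q) * \<mu> (snd q) * (\<phi> q y * \<phi> q z))" for y z
    unfolding calculus_def power2_eq_square sum_product sum.cartesian_product \<phi>_def
    by (intro sum.cong refl) (auto simp: algebra_simps)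
  have "(\<Sum>y\<in>W. v y * (calculus \<mu> x y)\<^sup>2)
      = (\<Sum>q\<in>?P. (\<Sum>y\<in>W. \<mu> (fst q) * \<mu> (snd q) * \<phi> q x * (v y * \<phi> q y)))"
    unfolding sq sum_distrib_left by (subst sum.swap) (simp add: algebra_simps)
  also have "\<dots> = (\<Sum>q\<in>?P. a q * b q)"
    unfolding a_def b_def
    by (intro sum.cong refl) (simp add: sum_distrib_left s ac_simps)
  finally have 1: "(\<Sum>y\<in>W. v y * (calculus \<mu> x y)\<^sup>2) = (\<Sum>q\<in>?P. a q * b q)" .
  have 2: "(calculus \<mu> x x)\<^sup>2 = (\<Sum>q\<in>?P. (a q)\<^sup>2)"
    unfolding sq a_def
    by (intro sum.cong refl) (simp add: s power2_eq_square ac_simps)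
  have "(\<Sum>y\<in>W. \<Sum>z\<in>W. v y * v z * (calculus \<mu> y z)\<^sup>2)
      = (\<Sum>y\<in>W. \<Sum>z\<in>W. \<Sum>q\<in>?P. (\<mu> (fst q) * \<mu> (snd q)) * ((v y * \<phi> q y) * (v z * \<phi> q z)))"
    unfolding sq sum_distrib_left by (simp add: algebra_simps)
  also have "\<dots> = (\<Sum>q\<in>?P. \<Sum>y\<in>W. \<Sum>z\<in>W. (\<mu> (fst q) * \<mu> (snd q)) * ((v y * \<phi> q y) * (v z * \<phi> q z)))"
    by (subst (2) sum.swap, subst sum.swap, rule refl)
  also have "\<dots> = (\<Sum>q\<in>?P. (b q)\<^sup>2)"
    unfolding b_def power2_eq_square
    by (intro sum.cong refl) (simp add: sum_product sum_distrib_left s ac_simps)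
  finally show ?thesis
    unfolding 1 2 using Cauchy_Schwarz_sum[of a b ?P] by simp
qed

lemma trace_square: "(\<Sum>x\<in>V. \<Sum>y\<in>V. (calculus \<mu> x y)\<^sup>2) = (\<Sum>k\<in>K. (\<mu> k)\<^sup>2)"
proof -
  have "(\<Sum>x\<in>V. \<Sum>y\<in>V. (calculus \<mu> x y)\<^sup>2) = (\<Sum>x\<in>V. \<Sum>y\<in>V. calculus \<mu> x y * calculus \<mu> y x)"
    by (intro sum.cong refl) (simp add: power2_eq_square calculus_sym)
  then show ?thesis by (simp add: calculus_mult calculus_trace power2_eq_square)
qed

section \<open>The positive and negative parts\<close>

definition B :: "'v \<Rightarrow> 'v \<Rightarrow> real" where "B = calculus (\<lambda>k. max (ev k) 0)"
definition C :: "'v \<Rightarrow> 'v \<Rightarrow> real" where "C = calculus (\<lambda>k. max (- ev k) 0)"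

definition nbrs :: "'v \<Rightarrow> 'v set" where "nbrs x = {y \<in> V. adj x y}"
definition nonisolated :: "'v set" where "nonisolated = {x \<in> V. nbrs x \<noteq> {}}"

definition \<beta> :: "'v \<Rightarrow> real" where "\<beta> x = (\<Sum>y\<in>V. (B x y)\<^sup>2)"
definition \<gamma> :: "'v \<Rightarrow> real" where "\<gamma> x = (\<Sum>y\<in>V. (C x y)\<^sup>2)"
text \<open>
The part of \<open>\<beta> x\<close> that the vertex bounds below have to recover separately: the shares that \<open>x\<close> hands
out to its non-neighbours do not occur in the sums over neighbours.
\<close>
definition far :: "'v \<Rightarrow> real" where "far x = (\<Sum>y\<in>V - insert x (nbrs x). (B x y)\<^sup>2)"
definition share :: "'v \<Rightarrow> 'v \<Rightarrow> real" where "share x y = (B x y)\<^sup>2 / \<beta> x"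

definition n_pos :: nat where "n_pos = card {k \<in> K. 0 < ev k}"
definition n_neg :: nat where "n_neg = card {k \<in> K. ev k < 0}"
definition s_pos :: real where "s_pos = (\<Sum>k | k \<in> K \<and> 0 < ev k. (ev k)\<^sup>2)"
definition s_neg :: real where "s_neg = (\<Sum>k | k \<in> K \<and> ev k < 0. (ev k)\<^sup>2)"

lemma finite_nbrs [simp]: "finite (nbrs x)" and nbrs_subset: "nbrs x \<subseteq> V"
  using finite_V by (auto simp: nbrs_def)

lemma nbrs_irrefl: "x \<in> V \<Longrightarrow> x \<notin> nbrs x"
  by (auto simp: nbrs_def adj_irrefl)

lemma nbrs_sym: "x \<in> V \<Longrightarrow> y \<in> nbrs x \<Longrightarrow> x \<in> nbrs y"
  by (auto simp: nbrs_def intro: adj_sym)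

lemma nbrs_nonisolated: "x \<in> V \<Longrightarrow> y \<in> nbrs x \<Longrightarrow> y \<in> nonisolated"
  using nbrs_sym[of x y] nbrs_subset[of x] by (auto simp: nonisolated_def)

lemma nonisolated_subset: "nonisolated \<subseteq> V" and finite_nonisolated [simp]: "finite nonisolated"
  using finite_V by (auto simp: nonisolated_def)

lemma B_sym: "B x y = B y x" and C_sym: "C x y = C y x"
  unfolding B_def C_def by (rule calculus_sym)+

lemma adj_eq_calculus: "x \<in> V \<Longrightarrow> y \<in> V \<Longrightarrow> of_bool (adj x y) = calculus ev x y"
  by (simp add: spectral calculus_def)

lemma B_minus_C: "x \<in> V \<Longrightarrow> y \<in> V \<Longrightarrow> B x y - C x y = of_bool (adj x y)"
  unfolding adj_eq_calculus B_def C_def calculus_def sum_subtractf[symmetric]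
  by (intro sum.cong refl) (simp add: max_def algebra_simps)

lemma C_eq: "x \<in> V \<Longrightarrow> y \<in> V \<Longrightarrow> C x y = B x y - of_bool (adj x y)"
  using B_minus_C[of x y] by simp

lemma sum_adj: "x \<in> V \<Longrightarrow> (\<Sum>y\<in>V. of_bool (adj x y) * g y) = (\<Sum>y\<in>nbrs x. g y)" for g :: "'v \<Rightarrow> real"
proof -
  have "(\<Sum>y\<in>V. of_bool (adj x y) * g y) = (\<Sum>y\<in>V. if adj x y then g y else 0)"
    by (intro sum.cong refl) simp
  then show ?thesis by (simp add: nbrs_def sum.inter_filter[OF finite_V])
qed

text \<open>
\<open>A B = B B\<close>, because \<open>A = B - C\<close> and \<open>C B = 0\<close>.
\<close>
lemma adj_B: "x \<in> V \<Longrightarrow> (\<Sum>y\<in>nbrs x. B y z) = (\<Sum>y\<in>V. B x y * B y z)"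
proof -
  assume x: "x \<in> V"
  have "(\<Sum>y\<in>nbrs x. B y z) = (\<Sum>y\<in>V. calculus ev x y * B y z)"
    unfolding sum_adj[OF x, symmetric] by (intro sum.cong refl) (simp add: adj_eq_calculus x)
  also have "\<dots> = (\<Sum>y\<in>V. B x y * B y z)"
    unfolding B_def calculus_mult by (rule arg_cong[of _ _ "\<lambda>f. calculus f x z"]) (auto simp: max_def)
  finally show ?thesis .
qed

lemma adj_C: "x \<in> V \<Longrightarrow> (\<Sum>y\<in>nbrs x. C y z) = - (\<Sum>y\<in>V. C x y * C y z)"
proof -
  assume x: "x \<in> V"
  have "(\<Sum>y\<in>nbrs x. C y z) = (\<Sum>y\<in>V. calculus ev x y * C y z)"
    unfolding sum_adj[OF x, symmetric] by (intro sum.cong refl) (simp add: adj_eq_calculus x)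
  also have "\<dots> = - (\<Sum>y\<in>V. C x y * C y z)"
    unfolding C_def calculus_mult unfolding calculus_def sum_negf[symmetric]
    by (intro sum.cong refl) (auto simp: max_def)
  finally show ?thesis .
qed

lemma \<beta>_eq: assumes "x \<in> V" shows "\<beta> x = (\<Sum>y\<in>nbrs x. B x y)"
  using adj_B[OF assms, of x] by (simp add: \<beta>_def power2_eq_square B_sym[of x])

lemma \<gamma>_eq: assumes x: "x \<in> V" shows "\<gamma> x = (\<Sum>y\<in>nbrs x. 1 - B x y)"
proof -
  have "\<gamma> x = - (\<Sum>y\<in>nbrs x. C y x)"
    using adj_C[OF x, of x] by (simp add: \<gamma>_def power2_eq_square C_sym[of x])
  also have "\<dots> = (\<Sum>y\<in>nbrs x. 1 - B x y)"
    unfolding sum_negf[symmetric]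
    by (intro sum.cong refl) (use x in \<open>auto simp: nbrs_def C_eq C_sym[of _ x]\<close>)
  finally show ?thesis .
qed

lemma \<gamma>_card: "x \<in> V \<Longrightarrow> \<gamma> x = card (nbrs x) - \<beta> x"
  by (simp add: \<gamma>_eq \<beta>_eq sum_subtractf)

lemma \<beta>_split:
  assumes "x \<in> V"
  shows "\<beta> x = (B x x)\<^sup>2 + (\<Sum>y\<in>nbrs x. (B x y)\<^sup>2) + far x"
proof -
  have "\<beta> x = far x + (\<Sum>y\<in>insert x (nbrs x). (B x y)\<^sup>2)"
    unfolding \<beta>_def far_def
    by (rule sum.subset_diff) (use assms nbrs_subset finite_V in auto)
  then show ?thesis by (simp add: nbrs_irrefl assms)
qed

lemma far_nonneg: "0 \<le> far x"
  by (simp add: far_def sum_nonneg)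

text \<open>
This compares the linear expression of \<open>\<beta> x\<close> as a sum over the neighbours with the quadratic one as
a squared norm.
\<close>
lemma sum_edge_product:
  assumes "x \<in> V"
  shows "(\<Sum>y\<in>nbrs x. B x y * (1 - B x y)) = (B x x)\<^sup>2 + far x"
  using \<beta>_split[OF assms] \<beta>_eq[OF assms]
  by (simp add: algebra_simps sum_subtractf power2_eq_square)

lemma C_diag: "x \<in> V \<Longrightarrow> C x x = B x x"
  by (simp add: C_eq adj_irrefl)

lemma B_Cauchy_Schwarz: "(\<Sum>y\<in>W. v y * B x y)\<^sup>2 \<le> B x x * (\<Sum>y\<in>W. \<Sum>z\<in>W. v y * v z * B y z)"
  unfolding B_def by (rule calculus_Cauchy_Schwarz) auto

lemma C_Cauchy_Schwarz: "(\<Sum>y\<in>W. v y * C x y)\<^sup>2 \<le> C x x * (\<Sum>y\<in>W. \<Sum>z\<in>W. v y * v z * C y z)"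
  unfolding C_def by (rule calculus_Cauchy_Schwarz) auto

lemma B_minor: "(B x y)\<^sup>2 \<le> B x x * B y y"
  using B_Cauchy_Schwarz[where W = "{y}" and v = "\<lambda>_. 1" and x = x] by simp

lemma C_minor: "(C x y)\<^sup>2 \<le> C x x * C y y"
  using C_Cauchy_Schwarz[where W = "{y}" and v = "\<lambda>_. 1" and x = x] by simp

lemma B_diag_nonneg: "0 \<le> B x x"
  unfolding B_def calculus_def by (intro sum_nonneg) (simp add: mult.assoc)

text \<open>
If the common diagonal entry of \<open>B\<close> and \<open>C\<close> at \<open>x\<close> vanished, then so would row \<open>x\<close> of both matrices,
and hence row \<open>x\<close> of \<open>A\<close>.
\<close>
lemma B_diag_pos:
  assumes "x \<in> nonisolated" shows "0 < B x x"
proof -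
  from assms obtain y where y: "x \<in> V" "y \<in> V" "adj x y" by (auto simp: nonisolated_def nbrs_def)
  have "\<not> B x x \<le> 0"
  proof
    assume "B x x \<le> 0"
    with B_diag_nonneg[of x] have "B x x = 0" by simp
    with B_minor[of x y] C_minor[of x y] C_diag y have "B x y = 0" "C x y = 0" by auto
    with B_minus_C[of x y] y show False by simp
  qed
  then show ?thesis by simp
qed

lemma diag_square_le: assumes "x \<in> V" shows "(B x x)\<^sup>2 \<le> \<beta> x" "(B x x)\<^sup>2 \<le> \<gamma> x"
proof -
  show "(B x x)\<^sup>2 \<le> \<beta> x" unfolding \<beta>_def by (rule member_le_sum) (use assms finite_V in auto)
  have "(C x x)\<^sup>2 \<le> \<gamma> x" unfolding \<gamma>_def by (rule member_le_sum) (use assms finite_V in auto)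
  with C_diag assms show "(B x x)\<^sup>2 \<le> \<gamma> x" by simp
qed

lemma \<beta>_pos: "x \<in> nonisolated \<Longrightarrow> 0 < \<beta> x" and \<gamma>_pos: "x \<in> nonisolated \<Longrightarrow> 0 < \<gamma> x"
  using diag_square_le[of x] B_diag_pos[of x] nonisolated_subset
  by (meson less_le_trans subsetD zero_less_power)+

lemma share_nonneg: "0 \<le> share x y"
  by (simp add: share_def \<beta>_def sum_nonneg)

lemma share_le_1: assumes "x \<in> V" "y \<in> V" shows "share x y \<le> 1"
proof -
  have "(B x y)\<^sup>2 \<le> \<beta> x" unfolding \<beta>_def by (rule member_le_sum) (use assms finite_V in auto)
  moreover have "0 \<le> \<beta> x" by (simp add: \<beta>_def sum_nonneg)
  ultimately show ?thesis by (auto simp: share_def divide_le_eq_1)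
qed

text \<open>
The entrywise square of \<open>B\<close> is tested against the vector \<open>z\<close> on the neighbours of \<open>i\<close>. Its row sums are
the \<open>\<beta> l\<close>, and the entry in column \<open>i\<close> of each row is not used by the neighbours, which turns the
quadratic form in \<open>z\<close> into the sum of \<open>share (1 - share)\<close>. The choice \<open>z l = |B i l| / \<beta> l\<close> is what
expresses everything in terms of the shares.
\<close>
lemma Hadamard_square_bounds:
  fixes i :: 'v
  defines "z \<equiv> \<lambda>l. \<bar>B i l\<bar> / \<beta> l"
  assumes i: "i \<in> V"
  shows "(\<Sum>l\<in>nbrs i. \<Sum>m\<in>nbrs i. z l * z m * (B l m)\<^sup>2) \<le> (\<Sum>l\<in>nbrs i. share l i * (1 - share l i))" (is "?R \<le> ?D")
    and "(\<Sum>l\<in>nbrs i. share l i * \<bar>B i l\<bar>)\<^sup>2 \<le> (B i i)\<^sup>2 * (\<Sum>l\<in>nbrs i. share l i * (1 - share l i))"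
proof -
  let ?N = "nbrs i"
  have zp: "z l * (B i l)\<^sup>2 = share l i * \<bar>B i l\<bar>" for l
    by (simp add: z_def share_def B_sym[of l i])
  have pos: "0 < \<beta> l" if "l \<in> ?N" for l
    using \<beta>_pos nbrs_nonisolated i that by blast
  \<comment> \<open>Column \<open>i\<close> is left out, since \<open>i\<close> is not its own neighbour.\<close>
  have row: "(\<Sum>m\<in>?N. (B l m)\<^sup>2) \<le> \<beta> l - (B l i)\<^sup>2" if "l \<in> ?N" for l
  proof -
    have "(\<Sum>m\<in>insert i ?N. (B l m)\<^sup>2) \<le> \<beta> l"
      unfolding \<beta>_def by (rule sum_mono2) (use finite_V nbrs_subset i in auto)
    then show ?thesis using nbrs_irrefl[OF i] by simp
  qed
  have "?R \<le> (\<Sum>l\<in>?N. \<Sum>m\<in>?N. ((z l)\<^sup>2 * (B l m)\<^sup>2 + (z m)\<^sup>2 * (B m l)\<^sup>2) / 2)"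
  proof (intro sum_mono)
    fix l m
    have "z l * z m \<le> ((z l)\<^sup>2 + (z m)\<^sup>2) / 2"
      using sum_squares_bound[of "z l" "z m"] by simp
    then have "z l * z m * (B l m)\<^sup>2 \<le> ((z l)\<^sup>2 + (z m)\<^sup>2) / 2 * (B l m)\<^sup>2"
      by (rule mult_right_mono) simp
    then show "z l * z m * (B l m)\<^sup>2 \<le> ((z l)\<^sup>2 * (B l m)\<^sup>2 + (z m)\<^sup>2 * (B m l)\<^sup>2) / 2"
      by (simp add: B_sym[of m l] algebra_simps)
  qed
  also have "\<dots> = ((\<Sum>l\<in>?N. \<Sum>m\<in>?N. (z l)\<^sup>2 * (B l m)\<^sup>2) + (\<Sum>l\<in>?N. \<Sum>m\<in>?N. (z m)\<^sup>2 * (B m l)\<^sup>2)) / 2"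
    by (simp add: sum.distrib sum_divide_distrib[symmetric])
  also have "(\<Sum>l\<in>?N. \<Sum>m\<in>?N. (z m)\<^sup>2 * (B m l)\<^sup>2) = (\<Sum>l\<in>?N. \<Sum>m\<in>?N. (z l)\<^sup>2 * (B l m)\<^sup>2)"
    by (rule sum.swap)
  also have "((\<Sum>l\<in>?N. \<Sum>m\<in>?N. (z l)\<^sup>2 * (B l m)\<^sup>2) + (\<Sum>l\<in>?N. \<Sum>m\<in>?N. (z l)\<^sup>2 * (B l m)\<^sup>2)) / 2
      = (\<Sum>l\<in>?N. (z l)\<^sup>2 * (\<Sum>m\<in>?N. (B l m)\<^sup>2))"
    by (simp only: field_sum_of_halves add_divide_distrib) (simp add: sum_distrib_left)
  also have "\<dots> \<le> (\<Sum>l\<in>?N. (z l)\<^sup>2 * (\<beta> l - (B l i)\<^sup>2))"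
    by (intro sum_mono mult_left_mono row) auto
  also have "\<dots> = ?D"
  proof (intro sum.cong refl)
    fix l assume l: "l \<in> ?N"
    show "(z l)\<^sup>2 * (\<beta> l - (B l i)\<^sup>2) = share l i * (1 - share l i)"
      using pos[OF l] by (simp add: z_def share_def B_sym[of l i] power2_eq_square field_simps)
  qed
  finally show R: "?R \<le> ?D" .
  have "(\<Sum>l\<in>?N. share l i * \<bar>B i l\<bar>)\<^sup>2 = (\<Sum>l\<in>?N. z l * (B i l)\<^sup>2)\<^sup>2"
    by (simp add: zp)
  also have "\<dots> \<le> (B i i)\<^sup>2 * ?R"
    unfolding B_def by (rule calculus_square_Cauchy_Schwarz) auto
  also have "\<dots> \<le> (B i i)\<^sup>2 * ?D"
    by (intro mult_left_mono R) auto
  finally show "(\<Sum>l\<in>?N. share l i * \<bar>B i l\<bar>)\<^sup>2 \<le> (B i i)\<^sup>2 * ?D" .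
qed

section \<open>The inequality at a single vertex\<close>

text \<open>
The number of neighbours minus the total share of \<open>i\<close> in their rows. Lower bounds for this number
are upper bounds for the shares.
\<close>
definition deficit :: "'v \<Rightarrow> real" where "deficit i = (\<Sum>l\<in>nbrs i. 1 - share l i)"

lemma deficit_split: "i \<in> V \<Longrightarrow> deficit i = (\<Sum>l\<in>nbrs i. share l i * (1 - share l i)) + (\<Sum>l\<in>nbrs i. (1 - share l i)\<^sup>2)"
  unfolding deficit_def sum.distrib[symmetric] by (intro sum.cong refl) (simp add: power2_eq_square algebra_simps)

lemma sum_share_product_nonneg: "i \<in> V \<Longrightarrow> 0 \<le> (\<Sum>l\<in>nbrs i. share l i * (1 - share l i))"
  using nbrs_subset[of i] by (intro sum_nonneg mult_nonneg_nonneg) (auto simp: share_nonneg share_le_1)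

text \<open>
Write \<open>\<beta> i\<close>, the sum of the \<open>B i l\<close>, as \<open>u + v\<close> by splitting each weight 1 into \<open>share\<close> and
\<open>1 - share\<close>. The Schur product bounds \<open>u\<^sup>2\<close> by \<open>(B i i)\<^sup>2\<close> times the sum of \<open>share (1 - share)\<close>, the
Cauchy--Schwarz inequality bounds \<open>v\<^sup>2\<close> by the sum of the \<open>(B i l)\<^sup>2\<close> times the sum of
\<open>(1 - share)\<^sup>2\<close>. The two right-hand factors add up to the deficit and the two left-hand ones to
\<open>\<beta> i - far i\<close>, so \<open>(\<beta> i)\<^sup>2 \<le> (\<beta> i - far i) * deficit i\<close>.
\<close>
lemma deficit_ge_\<beta>:
  assumes i: "i \<in> nonisolated"
  shows "\<beta> i + far i \<le> deficit i"
proof -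
  let ?N = "nbrs i" and ?D = "\<Sum>l\<in>nbrs i. share l i * (1 - share l i)"
  have iV: "i \<in> V" using i nonisolated_subset by auto
  have "(\<beta> i)\<^sup>2 = ((\<Sum>l\<in>?N. share l i * B i l) + (\<Sum>l\<in>?N. B i l * (1 - share l i)))\<^sup>2"
    unfolding \<beta>_eq[OF iV] sum.distrib[symmetric] by (simp add: algebra_simps)
  also have "\<dots> \<le> ((B i i)\<^sup>2 + (\<Sum>l\<in>?N. (B i l)\<^sup>2)) * (?D + (\<Sum>l\<in>?N. (1 - share l i)\<^sup>2))"
  proof (rule square_sum_le_product)
    have "\<bar>\<Sum>l\<in>?N. share l i * B i l\<bar> \<le> (\<Sum>l\<in>?N. share l i * \<bar>B i l\<bar>)"
      by (rule order_trans[OF sum_abs]) (simp add: abs_mult share_nonneg)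
    then have "(\<Sum>l\<in>?N. share l i * B i l)\<^sup>2 \<le> (\<Sum>l\<in>?N. share l i * \<bar>B i l\<bar>)\<^sup>2"
      by (rule abs_le_square_iff[THEN iffD1, OF order_trans[OF _ abs_ge_self]])
    with Hadamard_square_bounds(2)[OF iV] show "(\<Sum>l\<in>?N. share l i * B i l)\<^sup>2 \<le> (B i i)\<^sup>2 * ?D"
      by linarith
    show "(\<Sum>l\<in>?N. B i l * (1 - share l i))\<^sup>2 \<le> (\<Sum>l\<in>?N. (B i l)\<^sup>2) * (\<Sum>l\<in>?N. (1 - share l i)\<^sup>2)"
      by (rule Cauchy_Schwarz_sum)
  qed (auto intro: sum_nonneg sum_share_product_nonneg[OF iV])
  also have "\<dots> = (\<beta> i - far i) * deficit i"
    using \<beta>_split[OF iV] deficit_split[OF iV] by simp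
  finally have main: "(\<beta> i)\<^sup>2 \<le> (\<beta> i - far i) * deficit i" .
  \<comment> \<open>\<open>\<beta> - far\<close> is positive and \<open>(\<beta> - far) (\<beta> + far) \<le> \<beta>\<^sup>2\<close>, so \<open>\<beta> + far\<close> cannot exceed the deficit.\<close>
  have pos: "0 < \<beta> i - far i"
    using \<beta>_split[OF iV] B_diag_pos[OF i] by (simp add: add_pos_nonneg sum_nonneg)
  show ?thesis
  proof (rule ccontr)
    assume "\<not> ?thesis"
    then have "(\<beta> i - far i) * deficit i < (\<beta> i - far i) * (\<beta> i + far i)"
      using pos by simp
    also have "\<dots> \<le> (\<beta> i)\<^sup>2" by (simp add: power2_eq_square algebra_simps)
    finally show False using main by simp
  qed
qed

text \<open>
Here the degree \<open>d\<close>, and not \<open>\<beta> i\<close>, is split into shares and deficits. The sum of the shares is at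
most \<open>u + w\<close>, where \<open>u\<close> is the sum of \<open>share * |B i l|\<close> and \<open>w\<close> that of \<open>share * (1 - B i l)\<close>. The Schur
product bounds \<open>u\<^sup>2\<close>. For \<open>w\<close> note that \<open>1 - B i l = - C i l\<close>, so the Cauchy--Schwarz inequality for \<open>C\<close> bounds
\<open>w\<^sup>2\<close> by the quadratic form of \<open>C\<close> at the vector of shares; as this vector is non-negative, the form
of \<open>B\<close> is at least as large, and it leads back to the Schur product. Both bounds are the same, hence
\<open>d\<^sup>2 \<le> (4 (B i i)\<^sup>2 + d) * deficit i\<close>, and \<open>4 (B i i)\<^sup>2 \<le> d - 4 far i\<close> because \<open>h (1 - h) \<le> 1/4\<close>.
\<close>
lemma deficit_ge_half_degree:
  assumes i: "i \<in> nonisolated"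
  shows "card (nbrs i) / 2 + far i \<le> deficit i"
proof -
  let ?N = "nbrs i" and ?D = "\<Sum>l\<in>nbrs i. share l i * (1 - share l i)" and ?\<delta> = "B i i"
  define d where "d = real (card ?N)"
  define z where "z = (\<lambda>l. \<bar>B i l\<bar> / \<beta> l)"
  define u where "u = (\<Sum>l\<in>?N. share l i * \<bar>B i l\<bar>)"
  define w where "w = (\<Sum>l\<in>?N. share l i * (1 - B i l))"
  define qB where "qB = (\<Sum>l\<in>?N. \<Sum>m\<in>?N. share l i * share m i * B l m)"
  define R where "R = (\<Sum>l\<in>?N. \<Sum>m\<in>?N. z l * z m * (B l m)\<^sup>2)"
  have iV: "i \<in> V" using i nonisolated_subset by auto
  have z_nonneg: "0 \<le> z l" for l by (simp add: z_def \<beta>_def sum_nonneg)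
  have share_z: "share l i = z l * \<bar>B i l\<bar>" for l
    by (simp add: z_def share_def B_sym[of l i] power2_eq_square)
  have D0: "0 \<le> ?D" by (rule sum_share_product_nonneg[OF iV])
  have R: "R \<le> ?D" unfolding R_def z_def by (rule Hadamard_square_bounds(1)[OF iV])
  have u2: "u\<^sup>2 \<le> ?\<delta>\<^sup>2 * ?D" unfolding u_def by (rule Hadamard_square_bounds(2)[OF iV])
  have w1: "w\<^sup>2 \<le> ?\<delta> * qB"
  proof -
    have "w\<^sup>2 = (\<Sum>l\<in>?N. share l i * C i l)\<^sup>2"
    proof -
      have "w = - (\<Sum>l\<in>?N. share l i * C i l)"
        unfolding w_def sum_negf[symmetric]
        by (intro sum.cong refl) (use iV in \<open>auto simp: nbrs_def C_eq algebra_simps\<close>)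
      then show ?thesis by simp
    qed
    also have "\<dots> \<le> C i i * (\<Sum>l\<in>?N. \<Sum>m\<in>?N. share l i * share m i * C l m)"
      by (rule C_Cauchy_Schwarz)
    also have "\<dots> \<le> ?\<delta> * qB"
      unfolding C_diag[OF iV] qB_def
    proof (intro mult_left_mono sum_mono)
      fix l m assume "l \<in> ?N" "m \<in> ?N"
      then show "C l m \<le> B l m" using nbrs_subset by (subst C_eq) auto
    qed (auto simp: share_nonneg B_diag_nonneg)
    finally show ?thesis .
  qed
  \<comment> \<open>\<open>qB\<close> is the form of \<open>B\<close> at the shares, and each share is \<open>z l * |B i l|\<close>; the two factors
    are separated by the Cauchy--Schwarz inequality on pairs of neighbours with weights \<open>z l * z m\<close>.\<close>
  have qB2: "qB\<^sup>2 \<le> R * u\<^sup>2"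
  proof -
    let ?a = "\<lambda>(l, m). sqrt (z l * z m) * B l m"
    let ?b = "\<lambda>(l, m). sqrt (z l * z m) * (\<bar>B i l\<bar> * \<bar>B i m\<bar>)"
    have s: "sqrt (z l * z m) * sqrt (z l * z m) = z l * z m" for l m
      by (simp add: z_nonneg)
    have ab: "?a x * ?b x = (case x of (l, m) \<Rightarrow> share l i * share m i * B l m)" for x
    proof (cases x)
      case (Pair l m)
      have "?a x * ?b x = (sqrt (z l * z m) * sqrt (z l * z m)) * (B l m * (\<bar>B i l\<bar> * \<bar>B i m\<bar>))"
        unfolding Pair prod.case by (simp only: ac_simps)
      then show ?thesis unfolding s by (simp add: Pair share_z ac_simps)
    qed
    have aa: "(?a x)\<^sup>2 = (case x of (l, m) \<Rightarrow> z l * z m * (B l m)\<^sup>2)" for x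
      by (cases x) (simp add: power_mult_distrib z_nonneg)
    have bb: "(?b x)\<^sup>2 = (case x of (l, m) \<Rightarrow> (share l i * \<bar>B i l\<bar>) * (share m i * \<bar>B i m\<bar>))" for x
    proof (cases x)
      case (Pair l m)
      have "(?b x)\<^sup>2 = (sqrt (z l * z m) * sqrt (z l * z m)) * ((\<bar>B i l\<bar> * \<bar>B i m\<bar>) * (\<bar>B i l\<bar> * \<bar>B i m\<bar>))"
        unfolding Pair prod.case power2_eq_square by (simp only: ac_simps)
      then show ?thesis unfolding s by (simp add: Pair share_z ac_simps)
    qed
    have "qB = (\<Sum>x\<in>?N \<times> ?N. ?a x * ?b x)"
      unfolding qB_def sum.cartesian_product ab ..
    moreover have "R = (\<Sum>x\<in>?N \<times> ?N. (?a x)\<^sup>2)"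
      unfolding R_def sum.cartesian_product aa ..
    moreover have "u\<^sup>2 = (\<Sum>x\<in>?N \<times> ?N. (?b x)\<^sup>2)"
      unfolding u_def power2_eq_square sum_product sum.cartesian_product bb[unfolded power2_eq_square] ..
    ultimately show ?thesis using Cauchy_Schwarz_sum[of ?a ?b "?N \<times> ?N"] by simp
  qed
  have w2: "w\<^sup>2 \<le> ?\<delta>\<^sup>2 * ?D"
  proof (rule power2_le_imp_le)
    have "(w\<^sup>2)\<^sup>2 \<le> (?\<delta> * qB)\<^sup>2"
      using w1 by (intro power_mono) auto
    also have "\<dots> = ?\<delta>\<^sup>2 * qB\<^sup>2" by (simp add: power_mult_distrib)
    also have "\<dots> \<le> ?\<delta>\<^sup>2 * (?D * (?\<delta>\<^sup>2 * ?D))"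
      by (intro mult_left_mono order_trans[OF qB2] mult_mono R u2) (use D0 in auto)
    finally show "(w\<^sup>2)\<^sup>2 \<le> (?\<delta>\<^sup>2 * ?D)\<^sup>2" by (simp add: power2_eq_square algebra_simps)
  qed (use D0 in auto)
  have q2: "(\<Sum>l\<in>?N. share l i)\<^sup>2 \<le> 4 * ?\<delta>\<^sup>2 * ?D"
  proof -
    have "(\<Sum>l\<in>?N. share l i) \<le> u + w"
      unfolding u_def w_def sum.distrib[symmetric]
    proof (rule sum_mono)
      fix l
      have "share l i * B i l \<le> share l i * \<bar>B i l\<bar>" by (intro mult_left_mono) (auto simp: share_nonneg)
      then show "share l i \<le> share l i * \<bar>B i l\<bar> + share l i * (1 - B i l)" by (simp add: algebra_simps)
    qed
    then have "(\<Sum>l\<in>?N. share l i) \<le> u + \<bar>w\<bar>" by simp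
    moreover have "0 \<le> (\<Sum>l\<in>?N. share l i)" by (intro sum_nonneg) (simp add: share_nonneg)
    ultimately have "(\<Sum>l\<in>?N. share l i)\<^sup>2 \<le> (u + \<bar>w\<bar>)\<^sup>2" by (intro power_mono)
    also have "\<dots> \<le> 2 * u\<^sup>2 + 2 * w\<^sup>2"
      using sum_squares_bound[of u "\<bar>w\<bar>"] by (simp add: power2_sum)
    also have "\<dots> \<le> 4 * ?\<delta>\<^sup>2 * ?D" using u2 w2 by simp
    finally show ?thesis .
  qed
  have deficit2: "(deficit i)\<^sup>2 \<le> d * (\<Sum>l\<in>?N. (1 - share l i)\<^sup>2)"
    using Cauchy_Schwarz_sum[of "\<lambda>_. 1" "\<lambda>l. 1 - share l i" ?N] by (simp add: deficit_def d_def)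
  have "d\<^sup>2 = ((\<Sum>l\<in>?N. share l i) + deficit i)\<^sup>2"
    by (simp add: deficit_def d_def sum_subtractf)
  also have "\<dots> \<le> (4 * ?\<delta>\<^sup>2 + d) * (?D + (\<Sum>l\<in>?N. (1 - share l i)\<^sup>2))"
    by (rule square_sum_le_product) (use q2 deficit2 D0 in \<open>auto intro: sum_nonneg simp: d_def\<close>)
  also have "\<dots> = (4 * ?\<delta>\<^sup>2 + d) * deficit i"
    using deficit_split[OF iV] by simp
  finally have main: "d\<^sup>2 \<le> (4 * ?\<delta>\<^sup>2 + d) * deficit i" .
  have "(\<Sum>l\<in>?N. B i l * (1 - B i l)) \<le> (\<Sum>l\<in>?N. 1 / 4)"
  proof (rule sum_mono)
    fix l show "B i l * (1 - B i l) \<le> 1 / 4"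
      using zero_le_power2[of "B i l - 1 / 2"] by (simp add: power2_eq_square algebra_simps)
  qed
  then have \<delta>: "4 * ?\<delta>\<^sup>2 \<le> d - 4 * far i"
    using sum_edge_product[OF iV] by (simp add: d_def)
  have d1: "1 \<le> d"
    using i by (simp add: d_def nonisolated_def card_gt_0_iff Suc_le_eq)
  have deficit_nonneg: "0 \<le> deficit i"
    unfolding deficit_def using nbrs_subset[of i] iV by (intro sum_nonneg) (auto simp: share_le_1)
  have main': "d\<^sup>2 \<le> (2 * d - 4 * far i) * deficit i"
    by (rule order_trans[OF main]) (intro mult_right_mono, use \<delta> deficit_nonneg in auto)
  have pos: "0 < 2 * d - 4 * far i" using \<delta> d1 zero_le_power2[of ?\<delta>] by linarith
  have "d / 2 + far i \<le> deficit i"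
  proof (rule ccontr)
    assume "\<not> ?thesis"
    then have "(2 * d - 4 * far i) * deficit i < (2 * d - 4 * far i) * (d / 2 + far i)"
      using pos by simp
    also have "\<dots> \<le> d\<^sup>2" by (simp add: power2_eq_square algebra_simps)
    finally show False using main' by simp
  qed
  then show ?thesis by (simp add: d_def)
qed

text \<open>
For a vertex \<open>i\<close> with a single neighbour \<open>l\<close>, the entry \<open>B l l\<close> is the inner product of the rows
\<open>i\<close> and \<open>l\<close> of \<open>B\<close>, because \<open>B B = A B\<close> and row \<open>i\<close> of \<open>A\<close> has its only non-zero entry at \<open>l\<close>. Hence \<open>(B l l)\<^sup>2 \<le> \<beta> i * \<beta> l\<close>. On the other hand \<open>B l l = C l l\<close> is bounded below by
the principal minors on \<open>i, l\<close> of both \<open>B\<close> and \<open>C\<close>. Together they bound \<open>\<beta> l\<close> from below.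
\<close>
lemma pendant_bounds:
  assumes i: "i \<in> V" and N: "nbrs i = {l}"
  shows "share l i \<le> (B i i)\<^sup>2 / \<beta> i"
    and "\<beta> i \<le> \<gamma> i \<Longrightarrow> share l i \<le> (B i i)\<^sup>2 / \<gamma> i"
proof -
  let ?\<delta> = "B i i" and ?x = "B l l"
  have l: "l \<in> V" "adj i l" using N nbrs_subset[of i] by (auto simp: nbrs_def)
  have act: "i \<in> nonisolated" "l \<in> nonisolated" using i N nbrs_nonisolated by (auto simp: nonisolated_def)
  note pos = \<beta>_pos[OF act(1)] \<gamma>_pos[OF act(1)] \<beta>_pos[OF act(2)]
  have \<beta>: "\<beta> i = B i l" and \<gamma>: "\<gamma> i = 1 - B i l"
    using \<beta>_eq[OF i] \<gamma>_eq[OF i] N by auto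
  have C: "C i l = - \<gamma> i" using i l by (simp add: C_eq \<gamma>)
  have m1: "(\<beta> i)\<^sup>2 \<le> ?\<delta> * ?x" using B_minor[of i l] by (simp add: \<beta>)
  have m2: "(\<gamma> i)\<^sup>2 \<le> ?\<delta> * ?x" using C_minor[of i l] C C_diag i l by simp
  have "?x = (\<Sum>y\<in>V. B i y * B y l)"
    using adj_B[OF i, of l] N by simp
  also have "\<dots> = (\<Sum>y\<in>V. B i y * B l y)"
    by (intro sum.cong refl arg_cong2[where f = "(*)"] B_sym)
  finally have "?x = (\<Sum>y\<in>V. B i y * B l y)" .
  then have row: "?x\<^sup>2 \<le> \<beta> i * \<beta> l"
    using Cauchy_Schwarz_sum[of "B i" "B l" V] by (simp add: \<beta>_def)
  have key: "e ^ 4 \<le> \<beta> i * (?\<delta>\<^sup>2 * \<beta> l)" if "e\<^sup>2 \<le> ?\<delta> * ?x" for e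
  proof -
    have "e ^ 4 = (e\<^sup>2)\<^sup>2" by simp
    also have "\<dots> \<le> (?\<delta> * ?x)\<^sup>2" by (rule power_mono[OF that]) simp
    also have "\<dots> = ?\<delta>\<^sup>2 * ?x\<^sup>2" by (simp add: power_mult_distrib)
    also have "\<dots> \<le> ?\<delta>\<^sup>2 * (\<beta> i * \<beta> l)" by (intro mult_left_mono row) auto
    finally show ?thesis by (simp add: mult.left_commute)
  qed
  have share: "share l i = (\<beta> i)\<^sup>2 / \<beta> l" by (simp add: share_def \<beta> B_sym[of l i])
  have "\<beta> i * (\<beta> i) ^ 3 \<le> \<beta> i * (?\<delta>\<^sup>2 * \<beta> l)"
    using key[OF m1] by (simp add: numeral_eq_Suc)
  then have "(\<beta> i) ^ 3 \<le> ?\<delta>\<^sup>2 * \<beta> l" using pos by (simp add: mult_le_cancel_left_pos)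
  then show "share l i \<le> ?\<delta>\<^sup>2 / \<beta> i"
    unfolding share using pos by (simp add: field_simps numeral_eq_Suc)
  assume le: "\<beta> i \<le> \<gamma> i"
  have "\<beta> i * ((\<beta> i)\<^sup>2 * \<gamma> i) = (\<beta> i) ^ 3 * \<gamma> i" by (simp add: numeral_eq_Suc)
  also have "\<dots> \<le> (\<gamma> i) ^ 3 * \<gamma> i"
    using le pos by (intro mult_right_mono power_mono) auto
  also have "\<dots> \<le> \<beta> i * (?\<delta>\<^sup>2 * \<beta> l)"
    using key[OF m2] by (simp add: numeral_eq_Suc mult.commute)
  finally have "(\<beta> i)\<^sup>2 * \<gamma> i \<le> ?\<delta>\<^sup>2 * \<beta> l" using pos by (simp add: mult_le_cancel_left_pos)
  then show "share l i \<le> ?\<delta>\<^sup>2 / \<gamma> i"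
    unfolding share using pos by (simp add: field_simps)
qed

lemma sum_share: "(\<Sum>l\<in>nbrs i. share l i) = card (nbrs i) - deficit i"
  by (simp add: deficit_def sum_subtractf)

lemma degree_mult_le:
  assumes "i \<in> nonisolated"
  shows "card (nbrs i) * ((B i i)\<^sup>2 + far i) \<le> \<beta> i * \<gamma> i"
proof -
  have i: "i \<in> V" using assms nonisolated_subset by auto
  have "(\<beta> i)\<^sup>2 \<le> card (nbrs i) * (\<Sum>l\<in>nbrs i. (B i l)\<^sup>2)"
    using Cauchy_Schwarz_sum[of "\<lambda>_. 1" "B i" "nbrs i"] by (simp add: \<beta>_eq[OF i])
  also have "(\<Sum>l\<in>nbrs i. (B i l)\<^sup>2) = \<beta> i - ((B i i)\<^sup>2 + far i)"
    using \<beta>_split[OF i] by simp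
  finally show ?thesis
    by (simp add: \<gamma>_card[OF i] power2_eq_square algebra_simps)
qed

text \<open>
In terms of the deficit the claim reads \<open>\<beta> i + far i / \<beta> i \<le> deficit i\<close>. If \<open>\<beta> i \<ge> 1\<close> this is weaker
than \<open>deficit_ge_\<beta>\<close>. If \<open>\<beta> i < 1\<close> and the degree is at least 2, then half the degree exceeds \<open>\<beta> i\<close>
by enough to absorb \<open>far i / \<beta> i\<close>.
\<close>
lemma vertex_bound_\<beta>:
  assumes i: "i \<in> nonisolated"
  shows "far i / \<beta> i + (\<Sum>l\<in>nbrs i. share l i) \<le> \<gamma> i"
proof -
  have iV: "i \<in> V" using i nonisolated_subset by auto
  define d where "d = real (card (nbrs i))"
  have \<gamma>: "\<gamma> i = d - \<beta> i" by (simp add: d_def \<gamma>_card[OF iV])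
  have d0: "card (nbrs i) \<noteq> 0" using i by (simp add: nonisolated_def)
  note pos = \<beta>_pos[OF i] \<gamma>_pos[OF i]
  have "\<beta> i + far i / \<beta> i \<le> deficit i"
  proof (cases "card (nbrs i) = 1")
    case True
    then obtain l where N: "nbrs i = {l}" by (auto simp: card_1_singleton_iff)
    have "(B i i)\<^sup>2 + far i = \<beta> i * (1 - \<beta> i)"
      using sum_edge_product[OF iV] \<beta>_eq[OF iV] N by simp
    then have "\<beta> i + far i / \<beta> i = 1 - (B i i)\<^sup>2 / \<beta> i"
      using pos by (simp add: field_simps)
    with pendant_bounds(1)[OF iV N] show ?thesis by (simp add: deficit_def N)
  next
    case False
    with d0 have "2 \<le> card (nbrs i)" by linarith
    then have d2: "2 \<le> d" by (simp add: d_def)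
    show ?thesis
    proof (cases "1 \<le> \<beta> i")
      case True
      then have "far i / \<beta> i \<le> far i" using far_nonneg[of i] by (simp add: divide_le_eq mult_le_cancel_left1)
      with deficit_ge_\<beta>[OF i] show ?thesis by simp
    next
      case False
      define r where "r = far i / \<beta> i"
      have "d * far i \<le> \<beta> i * \<gamma> i"
        using degree_mult_le[OF i, folded d_def] mult_nonneg_nonneg[OF _ zero_le_power2, of d "B i i"] d2
        unfolding distrib_left by linarith
      then have r: "d * r \<le> d - \<beta> i" using pos by (simp add: r_def \<gamma> field_simps)
      have far: "far i = r * \<beta> i" using pos by (simp add: r_def)
      have "d * (r * (1 - \<beta> i)) \<le> (d - \<beta> i) * (1 - \<beta> i)"
        using r False by (simp add: mult.assoc[symmetric] mult_right_mono)
      also have "\<dots> \<le> d * (d / 2 - \<beta> i)"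
      proof -
        have "0 \<le> d * (d / 2 - 1) + \<beta> i * (1 - \<beta> i)"
          using d2 pos False by simp
        then show ?thesis by (simp add: algebra_simps)
      qed
      finally have "r * (1 - \<beta> i) \<le> d / 2 - \<beta> i" using d2 by simp
      then have "\<beta> i + r \<le> d / 2 + far i" by (simp add: far algebra_simps)
      with deficit_ge_half_degree[OF i] show ?thesis by (simp add: d_def r_def)
    qed
  qed
  then show ?thesis by (simp add: sum_share \<gamma> d_def)
qed

text \<open>
If \<open>\<gamma> i \<le> \<beta> i\<close>, this is weaker than \<open>vertex_bound_\<beta>\<close>. Otherwise \<open>\<beta> i\<close> is less than half the degree,
and the bound of the deficit by half the degree has room for the other terms. For degree at least 2
this uses \<open>far i / \<gamma> i \<le> far i\<close>: being more than half the degree, \<open>\<gamma> i\<close> is at least 1.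
\<close>
lemma vertex_bound_\<gamma>:
  assumes i: "i \<in> nonisolated"
  shows "((B i i)\<^sup>2 + far i) / \<beta> i + (\<Sum>l\<in>nbrs i. share l i) \<le> \<gamma> i + (B i i)\<^sup>2 / \<gamma> i"
proof (cases "\<gamma> i \<le> \<beta> i")
  case True
  then have "(B i i)\<^sup>2 / \<beta> i \<le> (B i i)\<^sup>2 / \<gamma> i"
    using \<gamma>_pos[OF i] by (intro divide_left_mono) auto
  with vertex_bound_\<beta>[OF i] show ?thesis by (simp add: add_divide_distrib)
next
  case False
  have iV: "i \<in> V" using i nonisolated_subset by auto
  define d where "d = real (card (nbrs i))"
  let ?\<tau> = "(B i i)\<^sup>2 + far i"
  have \<gamma>: "d - \<beta> i = \<gamma> i" by (simp add: d_def \<gamma>_card[OF iV])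
  have d0: "card (nbrs i) \<noteq> 0" using i by (simp add: nonisolated_def)
  note pos = \<beta>_pos[OF i] \<gamma>_pos[OF i]
  have "\<beta> i + ?\<tau> / \<beta> i - (B i i)\<^sup>2 / \<gamma> i \<le> deficit i"
  proof (cases "card (nbrs i) = 1")
    case True
    then obtain l where N: "nbrs i = {l}" by (auto simp: card_1_singleton_iff)
    have "?\<tau> = \<beta> i * \<gamma> i"
      using sum_edge_product[OF iV] \<beta>_eq[OF iV] \<gamma>_eq[OF iV] N by simp
    then have "?\<tau> / \<beta> i = \<gamma> i" using pos by simp
    moreover have "\<beta> i + \<gamma> i = 1" using \<gamma> True by (simp add: d_def)
    ultimately show ?thesis
      using pendant_bounds(2)[OF iV N] False by (simp add: deficit_def N)
  next
    case card: False
    with d0 have "2 \<le> card (nbrs i)" by linarith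
    then have d2: "2 \<le> d" by (simp add: d_def)
    have \<gamma>1: "1 \<le> \<gamma> i" using \<gamma> d2 False by linarith
    have "2 * ?\<tau> \<le> d * ?\<tau>" using d2 far_nonneg[of i] by (intro mult_right_mono) auto
    with degree_mult_le[OF i] have \<tau>: "2 * ?\<tau> \<le> \<beta> i * \<gamma> i" by (simp add: d_def)
    have "?\<tau> / \<beta> i - (B i i)\<^sup>2 / \<gamma> i = ?\<tau> * ((\<gamma> i - \<beta> i) / (\<beta> i * \<gamma> i)) + far i / \<gamma> i"
      using pos by (simp add: field_simps)
    also have "\<dots> \<le> (\<beta> i * \<gamma> i / 2) * ((\<gamma> i - \<beta> i) / (\<beta> i * \<gamma> i)) + far i"
    proof (rule add_mono)
      show "?\<tau> * ((\<gamma> i - \<beta> i) / (\<beta> i * \<gamma> i)) \<le> \<beta> i * \<gamma> i / 2 * ((\<gamma> i - \<beta> i) / (\<beta> i * \<gamma> i))"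
        using \<tau> False pos by (intro mult_right_mono) auto
      show "far i / \<gamma> i \<le> far i"
        using \<gamma>1 far_nonneg[of i] by (simp add: divide_le_eq mult_le_cancel_left1)
    qed
    also have "\<dots> = (\<gamma> i - \<beta> i) / 2 + far i" using pos by simp
    finally have "\<beta> i + ?\<tau> / \<beta> i - (B i i)\<^sup>2 / \<gamma> i \<le> d / 2 + far i"
      using \<gamma> by (simp add: field_simps)
    with deficit_ge_half_degree[OF i] show ?thesis by (simp add: d_def)
  qed
  then show ?thesis using \<gamma> by (simp add: sum_share d_def)
qed

section \<open>Negative square energy\<close>

lemma s_neg_eq: "s_neg = (\<Sum>x\<in>V. \<gamma> x)"
proof -
  have "(\<Sum>x\<in>V. \<gamma> x) = (\<Sum>k\<in>K. (max (- ev k) 0)\<^sup>2)"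
    unfolding \<gamma>_def C_def by (rule trace_square)
  also have "\<dots> = (\<Sum>k\<in>K. if ev k < 0 then (ev k)\<^sup>2 else 0)"
    by (intro sum.cong refl) (simp add: max_def)
  finally show ?thesis by (simp add: s_neg_def sum.inter_filter[OF finite_K, symmetric])
qed

text \<open>
With \<open>e\<close> the projection onto the range of \<open>M = calculus \<mu>\<close>, one has \<open>M x x = \<langle>M x, e x\<rangle>\<close>, so the
quotient in row \<open>x\<close> is at most the diagonal entry \<open>e x x\<close>. The trace of \<open>e\<close> is the rank of \<open>M\<close>.
\<close>
lemma diagonal_ratio_le:
  assumes pos: "\<And>x. x \<in> W \<Longrightarrow> 0 < (\<Sum>y\<in>V. (calculus \<mu> x y)\<^sup>2)" and W: "W \<subseteq> V"
  shows "(\<Sum>x\<in>W. (calculus \<mu> x x)\<^sup>2 / (\<Sum>y\<in>V. (calculus \<mu> x y)\<^sup>2)) \<le> card {k \<in> K. \<mu> k \<noteq> 0}"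
proof -
  let ?e = "\<lambda>k. of_bool (\<mu> k \<noteq> 0) :: real"
  have row: "(calculus \<mu> x x)\<^sup>2 \<le> (\<Sum>y\<in>V. (calculus \<mu> x y)\<^sup>2) * calculus ?e x x" for x
  proof -
    have "(\<Sum>y\<in>V. (calculus \<mu> x y)\<^sup>2) = (\<Sum>y\<in>V. calculus \<mu> x y * calculus \<mu> y x)"
      by (intro sum.cong refl) (simp add: power2_eq_square calculus_sym)
    also have "\<dots> = (\<Sum>k\<in>K. (\<mu> k * \<psi> k x)\<^sup>2)"
      unfolding calculus_mult by (simp add: calculus_def power2_eq_square algebra_simps)
    moreover have "calculus ?e x x = (\<Sum>k\<in>K. (?e k * \<psi> k x)\<^sup>2)"
      unfolding calculus_def power2_eq_square by (intro sum.cong refl) auto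
    moreover have "calculus \<mu> x x = (\<Sum>k\<in>K. (\<mu> k * \<psi> k x) * (?e k * \<psi> k x))"
      unfolding calculus_def by (intro sum.cong refl) auto
    ultimately show ?thesis
      using Cauchy_Schwarz_sum[of "\<lambda>k. \<mu> k * \<psi> k x" "\<lambda>k. ?e k * \<psi> k x" K] by simp
  qed
  have "(\<Sum>x\<in>W. (calculus \<mu> x x)\<^sup>2 / (\<Sum>y\<in>V. (calculus \<mu> x y)\<^sup>2)) \<le> (\<Sum>x\<in>W. calculus ?e x x)"
    using row pos by (intro sum_mono) (simp add: divide_le_eq mult.commute)
  also have "\<dots> \<le> (\<Sum>x\<in>V. calculus ?e x x)"
    by (rule sum_mono2[OF finite_V W]) (simp add: calculus_def sum_nonneg mult.assoc)
  also have "\<dots> = card {k \<in> K. \<mu> k \<noteq> 0}"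
    by (simp add: calculus_trace of_bool_def sum.inter_filter[OF finite_K, symmetric])
  finally show ?thesis .
qed

lemma sum_diag_\<beta>: "(\<Sum>x\<in>nonisolated. (B x x)\<^sup>2 / \<beta> x) \<le> n_pos"
proof -
  have "(\<Sum>x\<in>nonisolated. (B x x)\<^sup>2 / \<beta> x) \<le> card {k \<in> K. max (ev k) 0 \<noteq> 0}"
    using \<beta>_pos nonisolated_subset unfolding B_def \<beta>_def by (intro diagonal_ratio_le) auto
  also have "{k \<in> K. max (ev k) 0 \<noteq> 0} = {k \<in> K. 0 < ev k}" by (auto simp: max_def)
  finally show ?thesis by (simp add: n_pos_def)
qed

lemma sum_diag_\<gamma>: "(\<Sum>x\<in>nonisolated. (B x x)\<^sup>2 / \<gamma> x) \<le> n_neg"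
proof -
  have "(\<Sum>x\<in>nonisolated. (B x x)\<^sup>2 / \<gamma> x) = (\<Sum>x\<in>nonisolated. (C x x)\<^sup>2 / \<gamma> x)"
    using nonisolated_subset C_diag by (intro sum.cong) auto
  also have "\<dots> \<le> card {k \<in> K. max (- ev k) 0 \<noteq> 0}"
    using \<gamma>_pos nonisolated_subset unfolding C_def \<gamma>_def by (intro diagonal_ratio_le) auto
  also have "{k \<in> K. max (- ev k) 0 \<noteq> 0} = {k \<in> K. ev k < 0}" by (auto simp: max_def)
  finally show ?thesis by (simp add: n_neg_def)
qed

text \<open>
Exchanging the order of summation collects the shares in one row \<open>l\<close>. Their total over all vertices
is 1, and the vertices that are not neighbours of \<open>l\<close> take \<open>((B l l)\<^sup>2 + far l) / \<beta> l\<close> of it.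
\<close>
lemma sum_share_total:
  "(\<Sum>i\<in>nonisolated. \<Sum>l\<in>nbrs i. share l i) = real (card nonisolated) - (\<Sum>l\<in>nonisolated. ((B l l)\<^sup>2 + far l) / \<beta> l)"
proof -
  have "(\<Sum>i\<in>nonisolated. \<Sum>l\<in>nbrs i. share l i) = (\<Sum>i\<in>nonisolated. \<Sum>l | l \<in> nonisolated \<and> i \<in> nbrs l. share l i)"
    using nbrs_nonisolated nbrs_sym nonisolated_subset
    by (intro sum.cong refl) blast
  also have "\<dots> = (\<Sum>l\<in>nonisolated. \<Sum>i | i \<in> nonisolated \<and> i \<in> nbrs l. share l i)"
    by (rule sum.swap_restrict) auto
  also have "\<dots> = (\<Sum>l\<in>nonisolated. 1 - ((B l l)\<^sup>2 + far l) / \<beta> l)"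
  proof (rule sum.cong[OF refl])
    fix l assume l: "l \<in> nonisolated"
    then have lV: "l \<in> V" using nonisolated_subset by auto
    have "{i. i \<in> nonisolated \<and> i \<in> nbrs l} = nbrs l" using nbrs_nonisolated[OF lV] by auto
    then have "(\<Sum>i | i \<in> nonisolated \<and> i \<in> nbrs l. share l i) = (\<Sum>i\<in>nbrs l. (B l i)\<^sup>2) / \<beta> l"
      by (simp add: share_def sum_divide_distrib)
    also have "\<dots> = 1 - ((B l l)\<^sup>2 + far l) / \<beta> l"
      using \<beta>_split[OF lV] \<beta>_pos[OF l] by (simp add: field_simps)
    finally show "(\<Sum>i | i \<in> nonisolated \<and> i \<in> nbrs l. share l i) = 1 - ((B l l)\<^sup>2 + far l) / \<beta> l" .
  qed
  also have "\<dots> = real (card nonisolated) - (\<Sum>l\<in>nonisolated. ((B l l)\<^sup>2 + far l) / \<beta> l)"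
    by (simp add: sum_subtractf)
  finally show ?thesis .
qed

lemma s_neg_ge_nonisolated: "(\<Sum>i\<in>nonisolated. \<gamma> i) \<le> s_neg"
  unfolding s_neg_eq by (rule sum_mono2) (auto simp: finite_V nonisolated_def \<gamma>_def sum_nonneg)

lemma s_neg_ge_n_pos: "real (card nonisolated) - real n_pos \<le> s_neg"
proof -
  have "(\<Sum>i\<in>nonisolated. far i / \<beta> i + (\<Sum>l\<in>nbrs i. share l i)) \<le> (\<Sum>i\<in>nonisolated. \<gamma> i)"
    by (intro sum_mono vertex_bound_\<beta>)
  then show ?thesis
    using s_neg_ge_nonisolated sum_diag_\<beta> sum_share_total by (simp add: sum.distrib add_divide_distrib)
qed

lemma s_neg_ge_n_neg: "real (card nonisolated) - real n_neg \<le> s_neg"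
proof -
  have "(\<Sum>i\<in>nonisolated. ((B i i)\<^sup>2 + far i) / \<beta> i + (\<Sum>l\<in>nbrs i. share l i)) \<le> (\<Sum>i\<in>nonisolated. \<gamma> i + (B i i)\<^sup>2 / \<gamma> i)"
    by (intro sum_mono vertex_bound_\<gamma>)
  then show ?thesis
    using s_neg_ge_nonisolated sum_diag_\<gamma> sum_share_total by (simp add: sum.distrib)
qed

section \<open>Positive square energy\<close>

lemma s_pos_eq: "s_pos = (\<Sum>x\<in>V. \<beta> x)"
proof -
  have "(\<Sum>x\<in>V. \<beta> x) = (\<Sum>k\<in>K. (max (ev k) 0)\<^sup>2)"
    unfolding \<beta>_def B_def by (rule trace_square)
  also have "\<dots> = (\<Sum>k\<in>K. if 0 < ev k then (ev k)\<^sup>2 else 0)"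
    by (intro sum.cong refl) (simp add: max_def)
  finally show ?thesis by (simp add: s_pos_def sum.inter_filter[OF finite_K, symmetric])
qed

lemma adjacency_form_le:
  assumes "W \<subseteq> V"
  shows "(\<Sum>x\<in>W. \<Sum>y\<in>W. v x * v y * of_bool (adj x y)) \<le> (\<Sum>x\<in>W. \<Sum>y\<in>W. v x * v y * B x y)"
proof -
  have "(\<Sum>x\<in>W. \<Sum>y\<in>W. v x * v y * of_bool (adj x y)) = (\<Sum>x\<in>W. \<Sum>y\<in>W. v x * v y * calculus ev x y)"
    using assms by (intro sum.cong refl) (auto simp: adj_eq_calculus subset_iff)
  also have "\<dots> \<le> (\<Sum>x\<in>W. \<Sum>y\<in>W. v x * v y * B x y)"
    unfolding B_def calculus_form by (intro sum_mono mult_right_mono) auto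
  finally show ?thesis .
qed

text \<open>
The block of \<open>B\<close> on \<open>S\<close> is tested against the matrix \<open>w w\<^sup>T\<close>, where \<open>w\<close> is the Perron vector of the
complete bipartite graph between \<open>M\<close> and \<open>N\<close>. Further edges inside \<open>M\<close> or \<open>N\<close> only help, since \<open>w\<close>
is non-negative.
\<close>
lemma biclique_energy:
  fixes S M N :: "'v set"
  assumes S: "S = M \<union> N" "S \<subseteq> V" and ne: "M \<noteq> {}" "N \<noteq> {}" "M \<inter> N = {}"
    and adj: "\<And>x y. x \<in> M \<Longrightarrow> y \<in> N \<Longrightarrow> adj x y"
  shows "real (card S) - 1 \<le> (\<Sum>x\<in>S. \<Sum>y\<in>S. (B x y)\<^sup>2)"
proof -
  define t d where "t = real (card M)" and "d = real (card N)"
  \<comment> \<open>The two sides get equal total weight \<open>t * d\<close> in the squared norm.\<close>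
  define w where "w = (\<lambda>x. if x \<in> M then sqrt d else sqrt t)"
  let ?E = "\<Sum>x\<in>S. \<Sum>y\<in>S. (B x y)\<^sup>2"
  have fin: "finite M" "finite N" "finite S" using S finite_V finite_subset by auto
  have td: "1 \<le> t" "1 \<le> d"
    using ne fin by (auto simp: t_def d_def card_gt_0_iff Suc_le_eq)
  have w_nonneg: "0 \<le> w x" for x by (simp add: w_def t_def d_def)
  have wM: "w x = sqrt d" if "x \<in> M" for x using that by (simp add: w_def)
  have wN: "w x = sqrt t" if "x \<in> N" for x using that ne(3) by (auto simp: w_def)
  have norm: "(\<Sum>x\<in>S. (w x)\<^sup>2) = 2 * (t * d)"
    unfolding S(1) sum.union_disjoint[OF fin(1,2) ne(3)]
    using td by (simp add: wM wN t_def d_def)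
  let ?q = "\<lambda>x y. w x * w y * of_bool (adj x y)"
  have q_nonneg: "0 \<le> ?q x y" for x y by (simp add: w_nonneg)
  have cross: "(\<Sum>x\<in>M. \<Sum>y\<in>N. ?q x y) = t * d * sqrt (t * d)"
  proof -
    have "(\<Sum>x\<in>M. \<Sum>y\<in>N. ?q x y) = (\<Sum>x\<in>M. \<Sum>y\<in>N. sqrt d * sqrt t)"
      using adj by (intro sum.cong refl) (simp add: wM wN)
    then show ?thesis by (simp add: t_def d_def real_sqrt_mult)
  qed
  have cross': "(\<Sum>x\<in>N. \<Sum>y\<in>M. ?q x y) = t * d * sqrt (t * d)"
  proof -
    have "(\<Sum>x\<in>N. \<Sum>y\<in>M. ?q x y) = (\<Sum>x\<in>N. \<Sum>y\<in>M. sqrt d * sqrt t)"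
    proof (intro sum.cong refl)
      fix x y assume "x \<in> N" "y \<in> M"
      moreover then have "adj x y" using adj adj_sym S by blast
      ultimately show "?q x y = sqrt d * sqrt t" by (simp add: wM wN)
    qed
    then show ?thesis by (simp add: t_def d_def real_sqrt_mult)
  qed
  have "2 * (t * d * sqrt (t * d)) = (\<Sum>x\<in>M. \<Sum>y\<in>N. ?q x y) + (\<Sum>x\<in>N. \<Sum>y\<in>M. ?q x y)"
    using cross cross' by simp
  also have "\<dots> \<le> (\<Sum>x\<in>M. \<Sum>y\<in>S. ?q x y) + (\<Sum>x\<in>N. \<Sum>y\<in>S. ?q x y)"
    by (intro add_mono sum_mono sum_mono2) (use fin S q_nonneg in auto)
  also have "\<dots> = (\<Sum>x\<in>S. \<Sum>y\<in>S. ?q x y)"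
    using sum.union_disjoint[OF fin(1,2) ne(3), of "\<lambda>x. \<Sum>y\<in>S. ?q x y"] S(1) by simp
  also have "\<dots> \<le> (\<Sum>x\<in>S. \<Sum>y\<in>S. w x * w y * B x y)"
    by (rule adjacency_form_le[OF S(2)])
  finally have lower: "2 * (t * d * sqrt (t * d)) \<le> (\<Sum>x\<in>S. \<Sum>y\<in>S. w x * w y * B x y)" .
  have "(2 * (t * d * sqrt (t * d)))\<^sup>2 \<le> (\<Sum>x\<in>S. \<Sum>y\<in>S. w x * w y * B x y)\<^sup>2"
    using lower td by (intro power_mono) auto
  also have "\<dots> \<le> (\<Sum>x\<in>S. \<Sum>y\<in>S. (w x * w y)\<^sup>2) * ?E"
    using Cauchy_Schwarz_sum[of "\<lambda>(x, y). w x * w y" "\<lambda>(x, y). B x y" "S \<times> S"]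
    unfolding sum.cartesian_product by (simp add: case_prod_unfold)
  also have "(\<Sum>x\<in>S. \<Sum>y\<in>S. (w x * w y)\<^sup>2) = (2 * (t * d))\<^sup>2"
    unfolding norm[symmetric] power2_eq_square[of "\<Sum>x\<in>S. (w x)\<^sup>2"] sum_product
    by (simp add: power_mult_distrib)
  finally have "(2 * (t * d))\<^sup>2 * (t * d) \<le> (2 * (t * d))\<^sup>2 * ?E"
    using td by (simp add: power_mult_distrib)
  then have "t * d \<le> ?E" using td by (simp add: mult_le_cancel_left_pos)
  moreover have "t + d - 1 \<le> t * d"
    using mult_nonneg_nonneg[of "t - 1" "d - 1"] td by (simp add: algebra_simps)
  moreover have "real (card S) = t + d"
    unfolding S(1) using card_Un_disjoint[OF fin(1,2) ne(3)] by (simp add: t_def d_def)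
  ultimately show ?thesis by simp
qed

text \<open>
The coordinate space of \<open>U\<close> is isotropic for the quadratic form of the adjacency matrix, and the
rows of \<open>U\<close>, restricted to the columns in \<open>W\<close>, are linearly independent.
\<close>
definition isotropic :: "'v set \<Rightarrow> 'v set \<Rightarrow> bool" where
  "isotropic W U \<longleftrightarrow> U \<subseteq> W \<and> (\<forall>u\<in>U. \<forall>v\<in>U. \<not> adj u v)
    \<and> (\<forall>c. (\<forall>w\<in>W. (\<Sum>u\<in>U. c u * of_bool (adj u w)) = (0::real)) \<longrightarrow> (\<forall>u\<in>U. c u = 0))"

text \<open>
Choose a vertex \<open>u\<close> with the fewest neighbours in \<open>W\<close>, let \<open>M\<close> be the set of the vertices with the
same neighbourhood as \<open>u\<close>, and remove \<open>M\<close> together with this neighbourhood. A remaining vertex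
without remaining neighbours would have its neighbourhood contained in that of \<open>u\<close>, hence equal to
it by minimality, and would thus have been removed. As \<open>u\<close> has no neighbour among the remaining
vertices, it can be added to the set \<open>U\<close> that the induction provides for them. The two diagonal
blocks of \<open>B\<close>, on the removed and on the remaining vertices, are disjoint, so their energies add up.
\<close>
lemma isotropic_transversal:
  assumes "W \<subseteq> V" and "\<And>x. x \<in> W \<Longrightarrow> nbrs x \<inter> W \<noteq> {}"
  shows "\<exists>U. isotropic W U
    \<and> real (card W) - real (card U) \<le> (\<Sum>x\<in>W. \<Sum>y\<in>W. (B x y)\<^sup>2)"
  using finite_subset[OF assms(1) finite_V] assms
proof (induction W rule: finite_psubset_induct)
  case (psubset W)
  note W = psubset.prems(1) and noniso = psubset.prems(2)
  show ?case
  proof (cases "W = {}")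
    case True
    then show ?thesis by (intro exI[of _ "{}"]) (auto simp: isotropic_def)
  next
    case False
    define nb where "nb = (\<lambda>x. nbrs x \<inter> W)"
    obtain u where u: "u \<in> W" "\<And>x. x \<in> W \<Longrightarrow> card (nb u) \<le> card (nb x)"
      using ex_min_if_finite[of "(\<lambda>x. card (nb x)) ` W"] False psubset.hyps
      by (metis (no_types, lifting) arg_min_if_finite(1) arg_min_least)
    have fin: "finite (nb x)" for x by (simp add: nb_def)
    have nb_adj: "y \<in> nb x \<longleftrightarrow> y \<in> W \<and> adj x y" for x y using W by (auto simp: nb_def nbrs_def)
    have nb_sym: "x \<in> W \<Longrightarrow> y \<in> nb x \<Longrightarrow> x \<in> nb y" for x y
      using W adj_sym by (auto simp: nb_adj)
    define M where "M = {x \<in> W. nb x = nb u}"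
    define S where "S = M \<union> nb u"
    define W' where "W' = W - S"
    have uT: "u \<in> M" using u by (simp add: M_def)
    have SW: "S \<subseteq> W" by (auto simp: S_def M_def nb_def)
    have TN: "M \<inter> nb u = {}"
    proof -
      have False if "x \<in> M" "x \<in> nb u" for x
        using that W adj_irrefl nb_adj[of x x] by (auto simp: M_def)
      then show ?thesis by auto
    qed
    have "W' \<subset> W" using u(1) uT SW by (auto simp: W'_def S_def)
    moreover have "W' \<subseteq> V" using W by (auto simp: W'_def)
    moreover have "nbrs x \<inter> W' \<noteq> {}" if x: "x \<in> W'" for x
    proof
      assume none: "nbrs x \<inter> W' = {}"
      have xW: "x \<in> W" "x \<notin> M" "x \<notin> nb u" using x by (auto simp: W'_def S_def)
      have "nb x \<subseteq> nb u"
      proof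
        fix y assume y: "y \<in> nb x"
        then have "y \<in> S" using none by (auto simp: nb_def W'_def)
        moreover have "y \<notin> M"
          using nb_sym[OF xW(1) y] xW(3) by (auto simp: M_def)
        ultimately show "y \<in> nb u" by (auto simp: S_def)
      qed
      then have "nb x = nb u" using card_seteq[OF fin _ u(2)[OF xW(1)]] by blast
      then show False using xW by (auto simp: M_def)
    qed
    ultimately obtain U where iso: "isotropic W' U"
      and energy: "real (card W') - real (card U) \<le> (\<Sum>x\<in>W'. \<Sum>y\<in>W'. (B x y)\<^sup>2)"
      using psubset.IH[of W'] by blast
    have U: "U \<subseteq> W'" "\<forall>u\<in>U. \<forall>v\<in>U. \<not> adj u v"
      "\<forall>c. (\<forall>w\<in>W'. (\<Sum>u\<in>U. c u * of_bool (adj u w)) = (0::real)) \<longrightarrow> (\<forall>u\<in>U. c u = 0)"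
      using iso by (simp_all add: isotropic_def)
    have UW: "U \<subseteq> W" using U(1) by (auto simp: W'_def)
    have finU: "finite U" using UW psubset.hyps finite_subset by blast
    have u_notin: "u \<notin> U" using U(1) uT by (auto simp: W'_def S_def)
    have u_nonadj: "\<not> adj u w" if "w \<in> W'" for w
      using that nb_adj[of w u] by (auto simp: W'_def S_def)
    have "\<not> adj v w" if "v \<in> insert u U" "w \<in> insert u U" for v w
    proof -
      have "\<not> adj v u" if "v \<in> U" for v
        using u_nonadj[of v] adj_sym[of v u] that U(1) u(1) W by (auto simp: W'_def)
      then show ?thesis
        using that U(2) u_nonadj U(1) adj_irrefl u(1) W by blast
    qed
    moreover have "\<forall>v\<in>insert u U. c v = 0"
      if c: "\<forall>w\<in>W. (\<Sum>v\<in>insert u U. c v * of_bool (adj v w)) = (0::real)" for c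
    proof -
      have "\<forall>w\<in>W'. (\<Sum>v\<in>U. c v * of_bool (adj v w)) = 0"
        using c u_nonadj u_notin finU by (auto simp: W'_def)
      then have "\<forall>v\<in>U. c v = 0" using U(3) by blast
      moreover obtain w where "w \<in> nb u" using noniso[OF u(1)] by (auto simp: nb_def)
      then have "c u + (\<Sum>v\<in>U. c v * of_bool (adj v w)) = 0"
        using c u_notin finU by (auto simp: nb_adj)
      ultimately show ?thesis by simp
    qed
    moreover have "real (card W) - real (card (insert u U)) \<le> (\<Sum>x\<in>W. \<Sum>y\<in>W. (B x y)\<^sup>2)"
    proof -
      have "real (card S) - 1 \<le> (\<Sum>x\<in>S. \<Sum>y\<in>S. (B x y)\<^sup>2)"
      proof (rule biclique_energy[OF S_def])
        show "nb u \<noteq> {}" using noniso[OF u(1)] by (simp add: nb_def)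
        show "adj x y" if "x \<in> M" "y \<in> nb u" for x y
          using that nb_adj[of y x] by (auto simp: M_def)
      qed (use SW W uT TN in auto)
      moreover have "(\<Sum>x\<in>S. \<Sum>y\<in>S. (B x y)\<^sup>2) + (\<Sum>x\<in>W'. \<Sum>y\<in>W'. (B x y)\<^sup>2)
          \<le> (\<Sum>x\<in>S. \<Sum>y\<in>W. (B x y)\<^sup>2) + (\<Sum>x\<in>W'. \<Sum>y\<in>W. (B x y)\<^sup>2)"
        by (intro add_mono sum_mono sum_mono2) (use psubset.hyps SW in \<open>auto simp: W'_def\<close>)
      moreover have "(\<Sum>x\<in>S. \<Sum>y\<in>W. (B x y)\<^sup>2) + (\<Sum>x\<in>W'. \<Sum>y\<in>W. (B x y)\<^sup>2) = (\<Sum>x\<in>W. \<Sum>y\<in>W. (B x y)\<^sup>2)"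
        using sum.subset_diff[OF SW, of "\<lambda>x. \<Sum>y\<in>W. (B x y)\<^sup>2"] psubset.hyps by (simp add: W'_def)
      moreover have "card W = card S + card W'"
        using card_Diff_subset[of S W] card_mono[OF _ SW] psubset.hyps finite_subset[OF SW] SW
        by (simp add: W'_def)
      moreover have "card (insert u U) = Suc (card U)" using finU u_notin by simp
      ultimately show ?thesis using energy by simp
    qed
    ultimately show ?thesis
      using UW u(1) unfolding isotropic_def by (intro exI[of _ "insert u U"] conjI) auto
  qed
qed

text \<open>
If \<open>U\<close> were larger, the coordinate space of \<open>U\<close> would contain a vector \<open>c \<noteq> 0\<close> orthogonal to all
eigenvectors with \<open>\<sigma> * ev k > 0\<close>. All terms of the quadratic form at \<open>c\<close> then have the same sign, but
they add up to 0 because \<open>U\<close> is independent. So each of them vanishes, \<open>c\<close> lies in the kernel of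
the adjacency matrix, and this contradicts the independence of the rows. The sign \<open>\<sigma>\<close> covers
positive and negative eigenvalues at once.
\<close>
lemma isotropic_card_le_inertia:
  fixes \<sigma> :: real
  assumes U: "U \<subseteq> V" and indep: "\<And>u v. u \<in> U \<Longrightarrow> v \<in> U \<Longrightarrow> \<not> adj u v"
    and nondeg: "\<And>c. (\<And>w. w \<in> V \<Longrightarrow> (\<Sum>u\<in>U. c u * of_bool (adj u w)) = (0::real)) \<Longrightarrow> \<forall>u\<in>U. c u = 0"
    and \<sigma>: "\<sigma> \<noteq> 0"
  shows "card U \<le> card {k \<in> K. 0 < \<sigma> * ev k}"
proof (rule ccontr)
  assume "\<not> ?thesis"
  moreover have finU: "finite U" using U finite_V finite_subset by auto
  ultimately obtain c where c: "\<exists>u\<in>U. c u \<noteq> 0"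
    "\<And>k. k \<in> K \<Longrightarrow> 0 < \<sigma> * ev k \<Longrightarrow> (\<Sum>u\<in>U. c u * \<psi> k u) = 0"
    using homogeneous_system_solution[of "{k \<in> K. 0 < \<sigma> * ev k}" U \<psi>] finite_K by auto
  let ?s = "\<lambda>k. \<Sum>u\<in>U. c u * \<psi> k u"
  have "(\<Sum>k\<in>K. ev k * (?s k)\<^sup>2) = (\<Sum>x\<in>U. \<Sum>y\<in>U. c x * c y * calculus ev x y)"
    by (rule calculus_form[symmetric])
  also have "\<dots> = (\<Sum>x\<in>U. \<Sum>y\<in>U. c x * c y * of_bool (adj x y))"
    using U by (intro sum.cong refl) (auto simp: adj_eq_calculus subset_iff)
  also have "\<dots> = 0" using indep by simp
  finally have "(\<Sum>k\<in>K. - (\<sigma> * ev k * (?s k)\<^sup>2)) = 0"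
    by (simp add: sum_negf mult.assoc sum_distrib_left[symmetric])
  moreover have "0 \<le> - (\<sigma> * ev k * (?s k)\<^sup>2)" if "k \<in> K" for k
    using c(2)[OF that] by (cases "0 < \<sigma> * ev k") (auto simp: mult_nonpos_nonneg)
  ultimately have zero: "ev k * ?s k = 0" if "k \<in> K" for k
    using that \<sigma> finite_K by (subst (asm) sum_nonneg_eq_0_iff) auto
  have "(\<Sum>u\<in>U. c u * of_bool (adj u w)) = 0" if w: "w \<in> V" for w
  proof -
    have "(\<Sum>u\<in>U. c u * of_bool (adj u w)) = (\<Sum>u\<in>U. c u * (\<Sum>k\<in>K. ev k * \<psi> k u * \<psi> k w))"
      by (intro sum.cong refl arg_cong2[where f = "(*)"] spectral) (use U w in auto)
    also have "\<dots> = (\<Sum>k\<in>K. ev k * ?s k * \<psi> k w)"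
      unfolding sum_distrib_left sum_distrib_right by (subst sum.swap) (simp add: algebra_simps)
    also have "\<dots> = 0" using zero by (intro sum.neutral) auto
    finally show ?thesis .
  qed
  with nondeg c(1) show False by blast
qed

lemma s_pos_ge: "real (card nonisolated) - min (real n_pos) (real n_neg) \<le> s_pos"
proof -
  have noniso: "nbrs x \<inter> nonisolated \<noteq> {}" if "x \<in> nonisolated" for x
    using that nbrs_nonisolated[of x] nonisolated_subset by (auto simp: nonisolated_def)
  obtain U where iso: "isotropic nonisolated U"
    and energy: "real (card nonisolated) - real (card U) \<le> (\<Sum>x\<in>nonisolated. \<Sum>y\<in>nonisolated. (B x y)\<^sup>2)"
    using isotropic_transversal[OF nonisolated_subset noniso] by blast
  have U: "U \<subseteq> nonisolated" "\<forall>u\<in>U. \<forall>v\<in>U. \<not> adj u v"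
    "\<forall>c. (\<forall>w\<in>nonisolated. (\<Sum>u\<in>U. c u * of_bool (adj u w)) = (0::real)) \<longrightarrow> (\<forall>u\<in>U. c u = 0)"
    using iso by (simp_all add: isotropic_def)
  have UV: "U \<subseteq> V" using U(1) nonisolated_subset by auto
  have "card U \<le> card {k \<in> K. 0 < \<sigma> * ev k}" if "\<sigma> \<noteq> 0" for \<sigma>
  proof (rule isotropic_card_le_inertia[OF UV _ _ that])
    show "\<not> adj u v" if "u \<in> U" "v \<in> U" for u v using U(2) that by blast
    show "\<forall>u\<in>U. c u = 0" if "\<And>w. w \<in> V \<Longrightarrow> (\<Sum>u\<in>U. c u * of_bool (adj u w)) = (0::real)" for c
      using U(3) that nonisolated_subset by blast
  qed
  from this[of 1] this[of "-1"] have "card U \<le> n_pos" "card U \<le> n_neg"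
    by (simp_all add: n_pos_def n_neg_def)
  moreover have "(\<Sum>x\<in>nonisolated. \<Sum>y\<in>nonisolated. (B x y)\<^sup>2) \<le> s_pos"
  proof -
    have "(\<Sum>x\<in>nonisolated. \<Sum>y\<in>nonisolated. (B x y)\<^sup>2) \<le> (\<Sum>x\<in>nonisolated. \<beta> x)"
      unfolding \<beta>_def by (intro sum_mono sum_mono2) (use finite_V nonisolated_subset in auto)
    also have "\<dots> \<le> s_pos"
      unfolding s_pos_eq by (rule sum_mono2) (auto simp: finite_V nonisolated_def \<beta>_def sum_nonneg)
    finally show ?thesis .
  qed
  ultimately show ?thesis using energy by linarith
qed

end

section \<open>From the adjacency matrix to its square energies\<close>

text \<open>
Orthogonal diagonalisation is a similarity, so the characteristic polynomial is that of \<open>D\<close>.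
\<close>
lemma eigenvalue_mset_diagonalized:
  assumes A: "A \<in> carrier_mat n n" and P: "P \<in> carrier_mat n n" and D: "D \<in> carrier_mat n n"
    and PP: "P\<^sup>T * P = 1\<^sub>m n" and diag: "diagonal_mat D" and A_eq: "A = P * D * P\<^sup>T"
  shows "eigenvalue_mset A = image_mset (\<lambda>k. D $$ (k, k)) (mset_set {..<n})"
proof -
  have roots: "proots (\<Prod>a\<leftarrow>xs. [:- a, 1:]) = mset xs" for xs :: "real list"
  proof (induction xs)
    case (Cons a xs)
    have "(\<Prod>a\<leftarrow>xs. [:- a, 1:]) \<noteq> 0" by (auto simp: prod_list_zero_iff)
    then have "proots ([:- a, 1:] * (\<Prod>a\<leftarrow>xs. [:- a, 1:])) = {#a#} + mset xs"
      by (subst proots_mult) (simp_all add: Cons.IH)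
    then show ?case by simp
  qed simp
  have PT: "P\<^sup>T \<in> carrier_mat n n" using P by simp
  have "P * P\<^sup>T = 1\<^sub>m n" by (rule mat_mult_left_right_inverse[OF PT P PP])
  then have "similar_mat_wit A D P (P\<^sup>T)"
    using A D P PT PP A_eq by (intro similar_mat_witI[of _ _ n]) auto
  then have "char_poly A = char_poly D"
    by (intro char_poly_similar) (auto simp: similar_mat_def)
  also have "\<dots> = (\<Prod>a\<leftarrow>diag_mat D. [:- a, 1:])"
    by (rule char_poly_upper_triangular[OF D]) (use diag D in \<open>auto simp: diagonal_mat_def\<close>)
  also have "proots \<dots> = mset (diag_mat D)"
    by (rule roots)
  finally show ?thesis
    using D by (simp add: eigenvalue_mset_def diag_mat_def lessThan_atLeast0)
qed

lemma size_filter_image_mset_set: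
  "finite K \<Longrightarrow> size (filter_mset Q (image_mset f (mset_set K))) = card {k \<in> K. Q (f k)}"
  by (simp add: filter_mset_image_mset)

lemma sum_filter_image_mset_set:
  "finite K \<Longrightarrow> (\<Sum>x\<in>#filter_mset Q (image_mset f (mset_set K)). g x) = (\<Sum>k | k \<in> K \<and> Q (f k). g (f k))"
  by (simp add: filter_mset_image_mset sum_unfold_sum_mset image_mset.compositionality comp_def)

lemma isolated_count_enumeration:
  assumes "pair_graph G" and vs: "vertex_enumeration G vs"
  shows "isolated_count G = card {i \<in> {..<length vs}. \<forall>j<length vs. (vs ! i, vs ! j) \<notin> parcs G}"
proof -
  interpret pair_graph G by fact
  have dist: "distinct vs" and set: "set vs = pverts G"
    using vs by (auto simp: vertex_enumeration_def)
  have iso: "out_degree (with_proj G) v = 0 \<longleftrightarrow> (\<forall>j<length vs. (v, vs ! j) \<notin> parcs G)" for v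
  proof -
    have "out_degree (with_proj G) v = 0 \<longleftrightarrow> {e \<in> parcs G. fst e = v} = {}"
      by (simp add: out_degree_def out_arcs_def pair_finite_arcs)
    also have "\<dots> \<longleftrightarrow> (\<forall>w\<in>pverts G. (v, w) \<notin> parcs G)"
      using arc_snd_in_verts by force
    also have "\<dots> \<longleftrightarrow> (\<forall>j<length vs. (v, vs ! j) \<notin> parcs G)"
      unfolding set[symmetric] by (auto simp: set_conv_nth)
    finally show ?thesis .
  qed
  have "{v \<in> pverts G. out_degree (with_proj G) v = 0}
      = (!) vs ` {i \<in> {..<length vs}. \<forall>j<length vs. (vs ! i, vs ! j) \<notin> parcs G}"
    unfolding iso set[symmetric] by (auto simp: set_conv_nth)
  moreover have "inj_on ((!) vs) {i \<in> {..<length vs}. \<forall>j<length vs. (vs ! i, vs ! j) \<notin> parcs G}"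
    using dist by (auto simp: inj_on_def nth_eq_iff_index_eq)
  ultimately show ?thesis by (simp add: isolated_count_def card_image)
qed

theorem corollary4p3:
  fixes G :: "'a pair_pre_digraph" and vs :: "'a list"
  assumes "pair_graph G"
    and "vertex_enumeration G vs"
  defines "A \<equiv> adjacency_matrix G vs"
  shows "min (pos_square_energy A) (neg_square_energy A)
    \<ge> real (zero_inertia A) - real (isolated_count G) + real (max (pos_inertia A) (neg_inertia A))"
proof -
  interpret G: pair_graph G by fact
  define n where "n = length vs"
  define adj where "adj = (\<lambda>i j. (vs ! i, vs ! j) \<in> parcs G)"
  have A: "A \<in> carrier_mat n n" by (simp add: A_def adjacency_matrix_def n_def)
  have entry: "A $$ (i, j) = of_bool (adj i j)" if "i < n" "j < n" for i j
    using that by (simp add: A_def adjacency_matrix_def n_def adj_def)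
  have adj_sym: "adj j i" if "adj i j" for i j
    using that G.pair_sym_arcs by (auto simp: adj_def symmetric_def dest: symD)
  have "A\<^sup>T = A"
    using A entry adj_sym by (intro eq_matI) (auto simp: of_bool_def)
  then obtain P D where P: "P \<in> carrier_mat n n" and D: "D \<in> carrier_mat n n"
    and PP: "P\<^sup>T * P = 1\<^sub>m n" and diag: "diagonal_mat D" and A_eq: "A = P * D * P\<^sup>T"
    using symmetric_real_mat_diagonalization[OF A] by blast
  have eigs: "eigenvalue_mset A = image_mset (\<lambda>k. D $$ (k, k)) (mset_set {..<n})"
    by (rule eigenvalue_mset_diagonalized[OF A P D PP diag A_eq])
  interpret S: adjacency_eigenbasis "{..<n}" adj "{..<n}" "\<lambda>k. D $$ (k, k)" "\<lambda>k i. P $$ (i, k)"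
  proof
    show "\<not> adj i i" for i using G.pair_no_loops[of "(vs ! i, vs ! i)"] by (auto simp: adj_def)
    show "(\<Sum>i<n. P $$ (i, k) * P $$ (i, l)) = of_bool (k = l)" if "k \<in> {..<n}" "l \<in> {..<n}" for k l
    proof -
      have "(\<Sum>i<n. P $$ (i, k) * P $$ (i, l)) = (P\<^sup>T * P) $$ (k, l)"
        using that P by (simp add: scalar_prod_def lessThan_atLeast0)
      then show ?thesis using that by (simp add: PP)
    qed
    show "of_bool (adj i j) = (\<Sum>k<n. D $$ (k, k) * P $$ (i, k) * P $$ (j, k))"
      if ij: "i \<in> {..<n}" "j \<in> {..<n}" for i j
    proof -
      have PD: "(P * D) $$ (i, k) = P $$ (i, k) * D $$ (k, k)" if k: "k < n" for k
      proof -
        have "(P * D) $$ (i, k) = (\<Sum>l<n. P $$ (i, l) * D $$ (l, k))"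
          using ij k P D by (simp add: scalar_prod_def lessThan_atLeast0)
        also have "\<dots> = (\<Sum>l<n. if l = k then P $$ (i, k) * D $$ (k, k) else 0)"
          using diag D k by (intro sum.cong refl) (auto simp: diagonal_mat_def)
        finally show ?thesis using k by simp
      qed
      have PT: "(X * P\<^sup>T) $$ (i, j) = (\<Sum>k<n. X $$ (i, k) * P $$ (j, k))"
        if "X \<in> carrier_mat n n" for X
        using that ij P by (simp add: scalar_prod_def lessThan_atLeast0)
      have "of_bool (adj i j) = (P * D * P\<^sup>T) $$ (i, j)"
        using entry[of i j] ij by (simp add: A_eq)
      also have "\<dots> = (\<Sum>k<n. (P * D) $$ (i, k) * P $$ (j, k))"
        by (rule PT) (use P D in simp)
      also have "\<dots> = (\<Sum>k<n. D $$ (k, k) * P $$ (i, k) * P $$ (j, k))"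
        by (intro sum.cong refl) (simp add: PD)
      finally show ?thesis .
    qed
  qed (use adj_sym in auto)
  have s: "pos_square_energy A = S.s_pos" "neg_square_energy A = S.s_neg"
    unfolding pos_square_energy_def neg_square_energy_def eigs S.s_pos_def S.s_neg_def
    by (simp_all only: sum_filter_image_mset_set finite_lessThan)
  have inertia: "pos_inertia A = S.n_pos" "neg_inertia A = S.n_neg"
    unfolding pos_inertia_def neg_inertia_def eigs S.n_pos_def S.n_neg_def
    by (simp_all only: size_filter_image_mset_set finite_lessThan)
  have total: "zero_inertia A + pos_inertia A + neg_inertia A = n"
  proof -
    have "eigenvalue_mset A = filter_mset (\<lambda>x. x = 0) (eigenvalue_mset A)
        + filter_mset (\<lambda>x. x > 0) (eigenvalue_mset A) + filter_mset (\<lambda>x. x < 0) (eigenvalue_mset A)"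
      by (intro multiset_eqI) auto
    then have "size (eigenvalue_mset A) = zero_inertia A + pos_inertia A + neg_inertia A"
      unfolding zero_inertia_def pos_inertia_def neg_inertia_def by (metis size_union)
    then show ?thesis by (simp add: eigs)
  qed
  have "card S.nonisolated + isolated_count G = n"
  proof -
    have "isolated_count G = card {i \<in> {..<n}. \<forall>j<n. \<not> adj i j}"
      unfolding adj_def n_def by (rule isolated_count_enumeration[OF assms(1,2)])
    also have "{i \<in> {..<n}. \<forall>j<n. \<not> adj i j} = {..<n} - S.nonisolated"
      by (auto simp: S.nonisolated_def S.nbrs_def)
    finally have "isolated_count G = card ({..<n} - S.nonisolated)" .
    then show ?thesis
      using card_Diff_subset[OF S.finite_nonisolated S.nonisolated_subset]
        card_mono[OF _ S.nonisolated_subset] by simp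
  qed
  then have "real (zero_inertia A) - real (isolated_count G)
      = real (card S.nonisolated) - real (pos_inertia A) - real (neg_inertia A)"
    using total by linarith
  then show ?thesis
    using S.s_pos_ge S.s_neg_ge_n_pos S.s_neg_ge_n_neg unfolding s inertia
    by (simp add: min_def max_def split: if_splits)
qed

end
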